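(* Let $1<q<\infty$ with $q\neq2$, and let $r$ be defined by $1/q+1/r=1$. The map $M_\varrho\mapsto\langle\,\cdot\,,M_\varrho\rangle$ from $M\mathcal{S}_r$ to $(M\mathcal{S}_q)^\ast$ is not surjective.
   Context: $\mathbb{N}=\{1,2,3,\dots\}$. Infinite complex matrices indexed by $\mathbb{N}\times\mathbb{N}$ are regarded as linear operators on $\ell^2(\mathbb{N})$ with respect to the standard orthonormal basis. A compact operator $A$ on $\ell^2(\mathbb{N})$ belongs to the Schatten class $\mathcal{S}_q$ if its sequence of singular values $s(A)=(s_k(A))_{k\geq 0}$ is in $\ell^q$, and then $\|A\|_{\mathcal{S}_q}=\|s(A)\|_{\ell^q}$. A Helson matrix is an infinite matrix of the form $M_\varrho=(\varrho_{mn})_{m,n\geq1}$ for some sequence of complex numbers $\varrho=(\varrho_k)_{k\geq1}$. $M\mathcal{S}_q$ denotes the space of Helson matrices belonging to $\mathcal{S}_q$, with the norm of $\mathcal{S}_q$, and $(M\mathcal{S}_q)^\ast$ is its dual space of bounded linear functionals. The pairing is $\langle A,B\rangle=\operatorname{Tr}(AB^\ast)$ for $A\in\mathcal{S}_q$ and $B\in\mathcal{S}_r$; for $M_\varrho\in M\mathcal{S}_r$, $\langle\,\cdot\,,M_\varrho\rangle$ denotes the functional $A\mapsto\langle A,M_\varrho\rangle$ on $M\mathcal{S}_q$. *)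

theory Defs
  imports "HOL-Analysis.Analysis"
begin

text \<open>
  The Hilbert space of square-summable complex sequences indexed by the positive integers.
  A sequence is stored as a function on \<^typ>\<open>nat\<close> whose value at the unused index 0 is 0.
\<close>

typedef ell2 = "{x :: nat \<Rightarrow> complex. x 0 = 0 \<and> summable (\<lambda>n. (cmod (x n))\<^sup>2)}"
  morphisms coord Abs_ell2
  by (rule exI[of _ "\<lambda>_. 0"]) simp

setup_lifting type_definition_ell2

lemma coord_0 [simp]: "coord x 0 = 0"
  using coord[of x] by simp

lemma summable_coord_power2: "summable (\<lambda>n. (cmod (coord x n))\<^sup>2)"
  using coord[of x] by simp

lemma summable_norm_power2_add:
  assumes "summable (\<lambda>n. (cmod (x n))\<^sup>2)" and "summable (\<lambda>n. (cmod (y n))\<^sup>2)"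
  shows "summable (\<lambda>n. (cmod (x n + y n))\<^sup>2)"
proof (rule summable_comparison_test')
  show "summable (\<lambda>n. 2 * (cmod (x n))\<^sup>2 + 2 * (cmod (y n))\<^sup>2)"
    using assms by (intro summable_add summable_mult)
next
  fix n :: nat
  have "(cmod (x n + y n))\<^sup>2 \<le> (cmod (x n) + cmod (y n))\<^sup>2"
    by (intro power_mono norm_triangle_ineq) auto
  also have "\<dots> \<le> 2 * (cmod (x n))\<^sup>2 + 2 * (cmod (y n))\<^sup>2"
    using sum_squares_bound[of "cmod (x n)" "cmod (y n)"] by (simp add: power2_sum)
  finally show "norm ((cmod (x n + y n))\<^sup>2) \<le> 2 * (cmod (x n))\<^sup>2 + 2 * (cmod (y n))\<^sup>2"
    by simp
qed

lemma summable_coord_product: "summable (\<lambda>n. coord x n * cnj (coord y n))"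
proof (rule summable_comparison_test')
  show "summable (\<lambda>n. (cmod (coord x n))\<^sup>2 + (cmod (coord y n))\<^sup>2)"
    by (intro summable_add summable_coord_power2)
next
  fix n :: nat
  have "2 * (cmod (coord x n) * cmod (coord y n)) \<le> (cmod (coord x n))\<^sup>2 + (cmod (coord y n))\<^sup>2"
    using sum_squares_bound[of "cmod (coord x n)" "cmod (coord y n)"] by (simp add: mult.assoc)
  moreover have "0 \<le> cmod (coord x n) * cmod (coord y n)"
    by simp
  ultimately show "norm (coord x n * cnj (coord y n)) \<le> (cmod (coord x n))\<^sup>2 + (cmod (coord y n))\<^sup>2"
    by (simp only: norm_mult complex_mod_cnj)
qed

lift_definition scaleC :: "complex \<Rightarrow> ell2 \<Rightarrow> ell2" (infixr "*\<^sub>C" 75)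
  is "\<lambda>c x n. c * x n"
  by (auto simp: norm_mult power_mult_distrib intro: summable_mult)

definition cinner :: "ell2 \<Rightarrow> ell2 \<Rightarrow> complex"
  where "cinner x y = (\<Sum>n. coord x n * cnj (coord y n))"

instantiation ell2 :: real_inner
begin

lift_definition zero_ell2 :: ell2 is "\<lambda>_. 0"
  by simp

lift_definition plus_ell2 :: "ell2 \<Rightarrow> ell2 \<Rightarrow> ell2" is "\<lambda>x y n. x n + y n"
  by (auto intro: summable_norm_power2_add)

lift_definition uminus_ell2 :: "ell2 \<Rightarrow> ell2" is "\<lambda>x n. - x n"
  by simp

definition minus_ell2 :: "ell2 \<Rightarrow> ell2 \<Rightarrow> ell2"
  where "minus_ell2 x y = x + - y"

definition scaleR_ell2 :: "real \<Rightarrow> ell2 \<Rightarrow> ell2"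
  where "scaleR_ell2 r x = complex_of_real r *\<^sub>C x"

definition inner_ell2 :: "ell2 \<Rightarrow> ell2 \<Rightarrow> real"
  where "inner_ell2 x y = Re (cinner x y)"

definition norm_ell2 :: "ell2 \<Rightarrow> real"
  where "norm_ell2 x = sqrt (\<Sum>n. (cmod (coord x n))\<^sup>2)"

definition sgn_ell2 :: "ell2 \<Rightarrow> ell2"
  where "sgn_ell2 x = inverse (norm x) *\<^sub>R x"

definition dist_ell2 :: "ell2 \<Rightarrow> ell2 \<Rightarrow> real"
  where "dist_ell2 x y = norm (x - y)"

definition uniformity_ell2 :: "(ell2 \<times> ell2) filter"
  where "uniformity_ell2 = (INF e\<in>{0<..}. principal {(x, y). dist x y < e})"

definition open_ell2 :: "ell2 set \<Rightarrow> bool"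
  where "open_ell2 U = (\<forall>x\<in>U. \<forall>\<^sub>F (x', y) in uniformity. x' = x \<longrightarrow> y \<in> U)"

instance
proof
  fix x y z :: ell2 and a b :: real
  show "x + y + z = x + (y + z)" by transfer (simp add: add.assoc)
  show "x + y = y + x" by transfer (simp add: add.commute)
  show "0 + x = x" by transfer simp
  show "- x + x = 0" by transfer simp
  show "x - y = x + - y" by (rule minus_ell2_def)
  show "a *\<^sub>R (x + y) = a *\<^sub>R x + a *\<^sub>R y"
    unfolding scaleR_ell2_def by transfer (simp add: distrib_left)
  show "(a + b) *\<^sub>R x = a *\<^sub>R x + b *\<^sub>R x"
    unfolding scaleR_ell2_def by transfer (simp add: distrib_right)
  show "a *\<^sub>R b *\<^sub>R x = (a * b) *\<^sub>R x"
    unfolding scaleR_ell2_def by transfer (simp add: mult.assoc)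
  show "1 *\<^sub>R x = x"
    unfolding scaleR_ell2_def by transfer simp
  show "dist x y = norm (x - y)" by (rule dist_ell2_def)
  show "sgn x = inverse (norm x) *\<^sub>R x" by (rule sgn_ell2_def)
  show "uniformity = (INF e\<in>{0<..}. principal {(x, y :: ell2). dist x y < e})"
    by (rule uniformity_ell2_def)
  show "open U = (\<forall>x\<in>U. \<forall>\<^sub>F (x', y) in uniformity. x' = x \<longrightarrow> y \<in> U)" for U :: "ell2 set"
    by (rule open_ell2_def)
  have re: "inner x y = (\<Sum>n. Re (coord x n * cnj (coord y n)))" for x y
    unfolding inner_ell2_def cinner_def by (rule Re_suminf[OF summable_coord_product])
  have sre: "summable (\<lambda>n. Re (coord x n * cnj (coord y n)))" for x y
    by (rule summable_Re[OF summable_coord_product])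
  show "inner x y = inner y x"
    unfolding re by (simp add: mult.commute)
  show "inner (x + y) z = inner x z + inner y z"
    unfolding re by (subst suminf_add[OF sre sre])
      (simp add: plus_ell2.rep_eq algebra_simps)
  show "inner (a *\<^sub>R x) y = a * inner x y"
    unfolding re by (subst suminf_mult[OF sre, symmetric])
      (simp add: scaleR_ell2_def scaleC.rep_eq algebra_simps)
  have sq: "inner x x = (\<Sum>n. (cmod (coord x n))\<^sup>2)"
    unfolding re by (simp add: cmod_power2) (simp add: power2_eq_square)
  show "0 \<le> inner x x"
    unfolding sq by (rule suminf_nonneg[OF summable_coord_power2]) simp
  show "norm x = sqrt (inner x x)"
    unfolding sq by (rule norm_ell2_def)
  have "inner x x = 0 \<longleftrightarrow> (\<forall>n. coord x n = 0)"
    unfolding sq by (subst suminf_eq_zero_iff[OF summable_coord_power2]) simp_all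
  then show "inner x x = 0 \<longleftrightarrow> x = 0"
    by (auto simp: coord_inject[symmetric] zero_ell2.rep_eq fun_eq_iff)
qed

end

interpretation ell2: vector_space scaleC
  by unfold_locales (transfer, simp add: fun_eq_iff algebra_simps)+

text \<open>The standard orthonormal basis \<open>basis n\<close>, \<open>n \<ge> 1\<close>; by the encoding, \<open>basis 0 = 0\<close>.\<close>

lift_definition basis :: "nat \<Rightarrow> ell2"
  is "\<lambda>n k. if k = n \<and> 1 \<le> n then 1 else 0"
proof -
  fix n :: nat
  show "(if 0 = n \<and> 1 \<le> n then 1 else 0) = (0 :: complex) \<and>
      summable (\<lambda>k. (cmod (if k = n \<and> 1 \<le> n then 1 else 0))\<^sup>2)"
    using summable_finite[of "{n}" "\<lambda>k. (cmod (if k = n \<and> 1 \<le> n then 1 else 0))\<^sup>2"] by auto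
qed

definition represents :: "(nat \<Rightarrow> nat \<Rightarrow> complex) \<Rightarrow> (ell2 \<Rightarrow> ell2) \<Rightarrow> bool"
  where "represents M A \<longleftrightarrow> (\<forall>m\<ge>1. \<forall>n\<ge>1. cinner (A (basis n)) (basis m) = M m n)"

definition compact_operator :: "(ell2 \<Rightarrow> ell2) \<Rightarrow> bool"
  where "compact_operator A \<longleftrightarrow>
    Vector_Spaces.linear scaleC scaleC A \<and> compact (closure (A ` cball 0 1))"

definition hilbert_adjoint :: "(ell2 \<Rightarrow> ell2) \<Rightarrow> ell2 \<Rightarrow> ell2"
  where "hilbert_adjoint A = (THE B. \<forall>x y. cinner (A x) y = cinner x (B y))"

definition op_trace :: "(ell2 \<Rightarrow> ell2) \<Rightarrow> complex"
  where "op_trace T = (\<Sum>n. cinner (T (basis (Suc n))) (basis (Suc n)))"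

definition eigenspace :: "(ell2 \<Rightarrow> ell2) \<Rightarrow> complex \<Rightarrow> ell2 set"
  where "eigenspace T c = {x. T x = c *\<^sub>C x}"

text \<open>
  The singular values of a compact operator \<open>A\<close> are the square roots of the eigenvalues of
  \<open>A\<^sup>* A\<close>, in nonincreasing order and repeated according to multiplicity, followed by zeros if
  \<open>A\<close> has finite rank. For compact \<open>A\<close> this determines exactly one sequence: the eigenspaces
  concerned are finite-dimensional, and as \<open>s\<close> tends to 0, all the index sets below are finite.
\<close>

definition is_singular_value_sequence :: "(ell2 \<Rightarrow> ell2) \<Rightarrow> (nat \<Rightarrow> real) \<Rightarrow> bool"
  where "is_singular_value_sequence A s \<longleftrightarrow>
    (\<forall>k. 0 \<le> s k) \<and> decseq s \<and> s \<longlonglongrightarrow> 0 \<and>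
    (\<forall>\<mu>>0. card {k. s k = \<mu>} =
       ell2.dim (eigenspace (hilbert_adjoint A \<circ> A) (complex_of_real (\<mu>\<^sup>2))))"

definition singular_value :: "(ell2 \<Rightarrow> ell2) \<Rightarrow> nat \<Rightarrow> real"
  where "singular_value A = (THE s. is_singular_value_sequence A s)"

definition schatten_class :: "real \<Rightarrow> (ell2 \<Rightarrow> ell2) set"
  where "schatten_class q =
    {A. compact_operator A \<and> summable (\<lambda>k. singular_value A k powr q)}"

definition schatten_norm :: "real \<Rightarrow> (ell2 \<Rightarrow> ell2) \<Rightarrow> real"
  where "schatten_norm q A = (\<Sum>k. singular_value A k powr q) powr (1 / q)"

definition pairing :: "(ell2 \<Rightarrow> ell2) \<Rightarrow> (ell2 \<Rightarrow> ell2) \<Rightarrow> complex"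
  where "pairing A B = op_trace (A \<circ> hilbert_adjoint B)"

definition helson_matrix :: "(nat \<Rightarrow> complex) \<Rightarrow> nat \<Rightarrow> nat \<Rightarrow> complex"
  where "helson_matrix \<rho> m n = \<rho> (m * n)"

definition schatten_helson :: "real \<Rightarrow> (ell2 \<Rightarrow> ell2) set"
  where "schatten_helson q = {A \<in> schatten_class q. \<exists>\<rho>. represents (helson_matrix \<rho>) A}"

text \<open>
  Functionals on \<open>schatten_helson q\<close> are taken to be \<open>undefined\<close> outside that space, so that
  they are equal as soon as they agree on it.
\<close>

definition schatten_helson_dual :: "real \<Rightarrow> ((ell2 \<Rightarrow> ell2) \<Rightarrow> complex) set"
  where "schatten_helson_dual q =
    {\<phi> \<in> extensional (schatten_helson q).
       (\<forall>A\<in>schatten_helson q. \<forall>B\<in>schatten_helson q. \<phi> (\<lambda>x. A x + B x) = \<phi> A + \<phi> B) \<and>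
       (\<forall>c. \<forall>A\<in>schatten_helson q. \<phi> (\<lambda>x. c *\<^sub>C A x) = c * \<phi> A) \<and>
       (\<exists>C. \<forall>A\<in>schatten_helson q. cmod (\<phi> A) \<le> C * schatten_norm q A)}"

definition pairing_functional :: "real \<Rightarrow> (ell2 \<Rightarrow> ell2) \<Rightarrow> (ell2 \<Rightarrow> ell2) \<Rightarrow> complex"
  where "pairing_functional q M = (\<lambda>A\<in>schatten_helson q. pairing A M)"

end

theory Submission
  imports Defs "HOL-Computational_Algebra.Primes"
begin

text \<open>
  On finite matrices the orthogonal projection onto Helson matrices replaces every entry by the
  average over the entries \<open>(m, n)\<close> with the same product \<open>m n\<close>. A functional on Helson matrices that is given by
  pairing with an arbitrary matrix \<open>B\<close> can only be represented by the Helson matrix obtained from \<open>B\<close> by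
  averaging. So it suffices that averaging increases Schatten norms without bound.

  For the Hankel-type matrices on the indices \<open>1, p, p\<^sup>2, \<dots>\<close> with one prime \<open>p\<close>, averaging along antidiagonals already
  increases the norm of \<open>\<S>\<^sub>r\<close> for some matrix if \<open>r \<noteq> 2\<close>. By duality this is a statement about two matrices \<open>X\<close>
  and \<open>Y\<close>: the pairing of \<open>X\<close> with the average of \<open>Y\<close> exceeds \<open>\<parallel>X\<parallel>\<^sub>q \<parallel>Y\<parallel>\<^sub>r\<close>. It is symmetric in \<open>X\<close> and \<open>Y\<close>, so one
  may assume \<open>r > 2\<close>, and then \<open>X = v\<^sub>0 \<otimes> v\<^sub>0\<close>, \<open>Y = v\<^sub>0 \<otimes> v\<^sub>0 - \<delta> v\<^sub>1 \<otimes> v\<^sub>1\<close> works for an orthonormal basis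
  \<open>v\<^sub>0, v\<^sub>1\<close> of the plane that is rotated by a small angle (\<open>kappa_rank_one\<close>, \<open>small_angle_exists\<close>): the
  pairing gains a term of second order in \<open>\<delta>\<close> if the angle is of order \<open>\<delta>\<^bsup>1/2\<^esup>\<close>, whereas \<open>\<parallel>Y\<parallel>\<^sub>r\<close> only changes by a term of order \<open>\<delta>\<^sup>r\<close>.

  Independent primes make tensor powers available, and all quantities are multiplicative. The \<open>d\<close>-th
  tensor powers therefore have a gap that grows exponentially in \<open>d\<close>. The rows of the \<open>d\<close>-th matrix
  are multiplied by \<open>2\<^sup>d\<close>; since the other primes are odd, averaging never mixes two values of \<open>d\<close>, at the
  price of a factor \<open>d + 1\<close>, the number of divisors of \<open>2\<^sup>d\<close>. A weighted sum of the normalised tensor powers is then a bounded functional whose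
  only possible representing matrix is outside \<open>\<S>\<^sub>r\<close> (\<open>functional_not_representable\<close>).

  The facts on Schatten classes all follow from one inequality, \<open>schatten_coefficient_inequality\<close>: for
  orthonormal families \<open>u\<close>, \<open>v\<close>, the coefficients \<open>\<langle>A v\<^sub>j, u\<^sub>j\<rangle>\<close> have \<open>\<ell>\<^sup>q\<close> norm at most \<open>\<parallel>A\<parallel>\<^sub>q\<close>. It bounds the
  functional from above and the representing matrix from below, and it shows that \<open>\<S>\<^sub>q\<close> is closed under
  addition. It rests on the Schmidt decomposition of compact operators.
\<close>

section \<open>The inner product of square-summable sequences\<close>

lemma cinner_add_left: "cinner (x + y) z = cinner x z + cinner y z"
  unfolding cinner_def plus_ell2.rep_eq
  by (simp add: suminf_add[OF summable_coord_product summable_coord_product] distrib_right)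

lemma cinner_scaleC_left: "cinner (c *\<^sub>C x) y = c * cinner x y"
  unfolding cinner_def scaleC.rep_eq
  by (simp add: suminf_mult[OF summable_coord_product, symmetric] mult.assoc)

lemma cnj_cinner: "cnj (cinner x y) = cinner y x"
proof -
  have "(\<lambda>n. cnj (coord x n * cnj (coord y n))) sums cnj (cinner x y)"
    unfolding cinner_def sums_cnj by (rule summable_sums[OF summable_coord_product])
  then have "(\<lambda>n. coord y n * cnj (coord x n)) sums cnj (cinner x y)"
    by (simp add: mult.commute)
  then show ?thesis
    unfolding cinner_def by (simp add: sums_iff)
qed

lemma cinner_add_right: "cinner x (y + z) = cinner x y + cinner x z"
  by (metis cinner_add_left cnj_cinner complex_cnj_add)

lemma cinner_scaleC_right: "cinner x (c *\<^sub>C y) = cnj c * cinner x y"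
  by (metis cinner_scaleC_left cnj_cinner complex_cnj_mult)

lemma cinner_self: "cinner x x = of_real ((norm x)\<^sup>2)"
proof (rule complex_eqI)
  show "Re (cinner x x) = Re (of_real ((norm x)\<^sup>2))"
    by (simp add: inner_ell2_def[symmetric] power2_norm_eq_inner)
  show "Im (cinner x x) = Im (of_real ((norm x)\<^sup>2))"
    using cnj_cinner[of x x] by (simp add: complex_eq_iff)
qed

lemma norm_scaleC: "norm (c *\<^sub>C x) = cmod c * norm (x :: ell2)"
proof -
  have "complex_of_real ((norm (c *\<^sub>C x))\<^sup>2) = c * cnj c * of_real ((norm x)\<^sup>2)"
    unfolding cinner_self[symmetric] cinner_scaleC_left cinner_scaleC_right by (simp only: ac_simps)
  also have "\<dots> = of_real ((cmod c * norm x)\<^sup>2)"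
    by (simp add: complex_norm_square[symmetric] power_mult_distrib)
  finally have "(norm (c *\<^sub>C x))\<^sup>2 = (cmod c * norm x)\<^sup>2"
    by (simp only: of_real_eq_iff)
  then show ?thesis
    by (simp add: power2_eq_iff_nonneg)
qed

lemma cnj_mult_sgn: "cnj (sgn z) * z = of_real (cmod z)"
proof (cases "z = 0")
  case False
  have "cnj (sgn z) * z = z * cnj z / of_real (cmod z)"
    by (simp add: sgn_eq)
  then show ?thesis
    using False by (simp add: complex_norm_square[symmetric] power2_eq_square)
qed simp

text \<open>The phase of \<open>\<langle>x, y\<rangle>\<close> can be moved into \<open>x\<close>, so the real inequality suffices.\<close>

lemma cmod_cinner_le: "cmod (cinner x y) \<le> norm x * norm y"
proof (cases "cinner x y = 0")
  case False
  define c where "c = cnj (sgn (cinner x y))"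
  have c: "cmod c = 1"
    using False by (simp add: c_def norm_sgn)
  have "c * cinner x y = of_real (cmod (cinner x y))"
    using False cnj_mult_sgn by (simp add: c_def)
  then have "cmod (cinner x y) = inner (c *\<^sub>C x) y"
    by (simp add: inner_ell2_def cinner_scaleC_left)
  also have "\<dots> \<le> norm (c *\<^sub>C x) * norm y"
    by (rule norm_cauchy_schwarz)
  finally show ?thesis
    by (simp add: norm_scaleC c)
qed simp

interpretation cinner: bounded_bilinear cinner
proof
  show "\<exists>K. \<forall>a b. cmod (cinner a b) \<le> norm a * norm b * K"
    using cmod_cinner_le by (intro exI[of _ 1]) simp
qed (simp_all add: cinner_add_left cinner_add_right scaleR_ell2_def cinner_scaleC_left
    cinner_scaleC_right scaleR_conv_of_real)

declare cinner.zero_left [simp] cinner.zero_right [simp]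

lemma cinner_commute_zero: "cinner x y = 0 \<longleftrightarrow> cinner y x = 0"
  using cnj_cinner[of x y] by (metis complex_cnj_zero_iff)

lemma norm_eqI_cinner: "cinner x x = of_real (a\<^sup>2) \<Longrightarrow> 0 \<le> a \<Longrightarrow> norm x = a"
  unfolding cinner_self of_real_eq_iff by (simp add: power2_eq_iff_nonneg)

lemma cinner_basis_right: "cinner x (basis n) = coord x n"
proof -
  have "(\<lambda>k. coord x k * cnj (coord (basis n) k)) sums (\<Sum>k\<in>{n}. coord x k * cnj (coord (basis n) k))"
    by (rule sums_finite) (auto simp: basis.rep_eq)
  then have "cinner x (basis n) = coord x n * cnj (coord (basis n) n)"
    unfolding cinner_def by (simp add: sums_iff)
  then show ?thesis
    by (cases "n = 0") (simp_all add: basis.rep_eq)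
qed

lemma cinner_basis_left: "cinner (basis n) x = cnj (coord x n)"
  by (metis cinner_basis_right cnj_cinner)

lemma coord_sum: "coord (sum f I) n = (\<Sum>i\<in>I. coord (f i) n)"
  by (simp only: cinner_basis_right[symmetric] cinner.sum_left)

lemma coord_basis: "coord (basis n) k = (if k = n \<and> 1 \<le> n then 1 else 0)"
  by (simp add: basis.rep_eq)

lemma ell2_eqI: "(\<And>n. coord x n = coord y n) \<Longrightarrow> x = y"
  by (simp add: coord_inject[symmetric] fun_eq_iff)

lemma ell2_cinner_eqI: "(\<And>z. cinner x z = cinner y z) \<Longrightarrow> x = y"
  by (rule ell2_eqI) (metis cinner_basis_right)

lemma finite_basis_expansion_tendsto: "(\<lambda>N. \<Sum>n<N. coord x n *\<^sub>C basis n) \<longlonglongrightarrow> x"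
proof (rule LIMSEQ_I)
  fix e :: real assume e: "0 < e"
  have c: "coord (x - (\<Sum>n<N. coord x n *\<^sub>C basis n)) k = (if k < N then 0 else coord x k)" for N k
  proof -
    have "coord (x - (\<Sum>n<N. coord x n *\<^sub>C basis n)) k
        = coord x k - (\<Sum>n<N. coord x n * coord (basis n) k)"
      by (simp add: cinner_basis_right[symmetric] cinner.diff_left cinner.sum_left cinner_scaleC_left)
    also have "(\<Sum>n<N. coord x n * coord (basis n) k) = (\<Sum>n<N. if n = k then coord x k else 0)"
      by (intro sum.cong) (auto simp: coord_basis not_le)
    finally show ?thesis by simp
  qed
  have "(\<lambda>N. (\<Sum>k. (cmod (coord x (k + N)))\<^sup>2)) \<longlonglongrightarrow> 0"
    using suminf_exist_split2[OF summable_coord_power2] .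
  then obtain N0 where N0: "\<And>N. N \<ge> N0 \<Longrightarrow> norm (\<Sum>k. (cmod (coord x (k + N)))\<^sup>2) < e\<^sup>2"
    using e by (metis LIMSEQ_D diff_zero zero_less_power)
  show "\<exists>no. \<forall>N\<ge>no. norm ((\<Sum>n<N. coord x n *\<^sub>C basis n) - x) < e"
  proof (intro exI allI impI)
    fix N assume "N0 \<le> N"
    define y where "y = x - (\<Sum>n<N. coord x n *\<^sub>C basis n)"
    have "(norm y)\<^sup>2 = (\<Sum>k. (cmod (coord y k))\<^sup>2)"
      by (simp add: norm_ell2_def suminf_nonneg[OF summable_coord_power2])
    also have "\<dots> = (\<Sum>k. (cmod (coord y (k + N)))\<^sup>2) + (\<Sum>k<N. (cmod (coord y k))\<^sup>2)"
      by (rule suminf_split_initial_segment[OF summable_coord_power2])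
    also have "\<dots> = (\<Sum>k. (cmod (coord x (k + N)))\<^sup>2)"
      by (simp add: y_def c)
    also have "\<dots> < e\<^sup>2"
      using N0[OF \<open>N0 \<le> N\<close>] by simp
    finally have "norm y < e"
      using e by (simp add: power_less_imp_less_base)
    then show "norm ((\<Sum>n<N. coord x n *\<^sub>C basis n) - x) < e"
      by (simp add: y_def norm_minus_commute)
  qed
qed

section \<open>Orthogonal families of contractive vectors\<close>

text \<open>
  Zero vectors are allowed in such a family, which lets a finite Schmidt expansion be continued by
  zeros to an infinite sequence.
\<close>

definition suborthonormal :: "'a set \<Rightarrow> ('a \<Rightarrow> ell2) \<Rightarrow> bool"
  where "suborthonormal J u \<longleftrightarrow>
    (\<forall>i\<in>J. norm (u i) \<le> 1) \<and> (\<forall>i\<in>J. \<forall>j\<in>J. i \<noteq> j \<longrightarrow> cinner (u i) (u j) = 0)"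

lemma suborthonormal_subset: "suborthonormal J u \<Longrightarrow> I \<subseteq> J \<Longrightarrow> suborthonormal I u"
  by (simp add: suborthonormal_def subset_iff)

lemma suborthonormalI:
  assumes "\<And>i j. i \<in> J \<Longrightarrow> j \<in> J \<Longrightarrow> cinner (u i) (u j) = (if i = j then 1 else 0)"
  shows "suborthonormal J u"
  unfolding suborthonormal_def
proof (intro conjI ballI impI)
  fix i assume "i \<in> J"
  then have "norm (u i) = 1"
    using assms[of i i] by (intro norm_eqI_cinner[of "u i" 1]) simp_all
  then show "norm (u i) \<le> 1" by simp
qed (simp add: assms)

lemma cinner_sum_orthogonal:
  assumes "finite J" "\<And>i j. i \<in> J \<Longrightarrow> j \<in> J \<Longrightarrow> i \<noteq> j \<Longrightarrow> cinner (u i) (u j) = 0" "j \<in> J"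
  shows "cinner (\<Sum>i\<in>J. c i *\<^sub>C u i) (u j) = c j * of_real ((norm (u j))\<^sup>2)"
proof -
  have "cinner (\<Sum>i\<in>J. c i *\<^sub>C u i) (u j) = (\<Sum>i\<in>J. c i * cinner (u i) (u j))"
    by (simp add: cinner.sum_left cinner_scaleC_left)
  also have "\<dots> = (\<Sum>i\<in>J. if i = j then c j * cinner (u j) (u j) else 0)"
    using assms by (intro sum.cong) auto
  finally show ?thesis
    using assms by (simp add: cinner_self)
qed

lemma norm_diff_projection:
  assumes "finite J" "suborthonormal J u"
  shows "(norm (x - (\<Sum>j\<in>J. cinner x (u j) *\<^sub>C u j)))\<^sup>2
      = (norm x)\<^sup>2 - (\<Sum>j\<in>J. (cmod (cinner x (u j)))\<^sup>2 * (2 - (norm (u j))\<^sup>2))"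
proof -
  define c where "c j = cinner x (u j)" for j
  define y where "y = (\<Sum>j\<in>J. c j *\<^sub>C u j)"
  have yu: "cinner y (u j) = c j * of_real ((norm (u j))\<^sup>2)" if "j \<in> J" for j
    unfolding y_def by (rule cinner_sum_orthogonal[OF assms(1) _ that])
      (use assms(2) in \<open>simp add: suborthonormal_def\<close>)
  have xy: "cinner x y = (\<Sum>j\<in>J. of_real ((cmod (c j))\<^sup>2))"
    unfolding y_def cinner.sum_right cinner_scaleC_right
    by (intro sum.cong refl) (simp only: c_def[symmetric] complex_norm_square mult.commute)
  have yx: "cinner y x = (\<Sum>j\<in>J. of_real ((cmod (c j))\<^sup>2))"
    using cnj_cinner[of x y] unfolding xy by simp
  have yy: "cinner y y = (\<Sum>j\<in>J. of_real ((cmod (c j))\<^sup>2 * (norm (u j))\<^sup>2))"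
    unfolding y_def cinner.sum_right cinner_scaleC_right
  proof (intro sum.cong refl)
    fix j assume "j \<in> J"
    have "cnj (c j) * cinner (\<Sum>j\<in>J. c j *\<^sub>C u j) (u j) = (c j * cnj (c j)) * of_real ((norm (u j))\<^sup>2)"
      using yu[OF \<open>j \<in> J\<close>] by (simp add: y_def)
    then show "cnj (c j) * cinner (\<Sum>j\<in>J. c j *\<^sub>C u j) (u j)
        = of_real ((cmod (c j))\<^sup>2 * (norm (u j))\<^sup>2)"
      by (simp only: of_real_mult complex_norm_square)
  qed
  have "complex_of_real ((norm (x - y))\<^sup>2) = cinner x x - cinner x y - cinner y x + cinner y y"
    unfolding cinner_self[symmetric] by (simp add: cinner.diff_left cinner.diff_right)
  also have "\<dots> = of_real ((norm x)\<^sup>2 - (\<Sum>j\<in>J. (cmod (c j))\<^sup>2 * (2 - (norm (u j))\<^sup>2)))"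
    unfolding xy yx yy unfolding cinner_self
    by (simp add: right_diff_distrib sum_subtractf sum_distrib_left mult.commute flip: sum_negf)
  finally show ?thesis
    unfolding of_real_eq_iff c_def y_def .
qed

lemma Bessel_inequality:
  assumes "finite J" "suborthonormal J u"
  shows "(\<Sum>j\<in>J. (cmod (cinner x (u j)))\<^sup>2) \<le> (norm x)\<^sup>2"
proof -
  have "(\<Sum>j\<in>J. (cmod (cinner x (u j)))\<^sup>2)
      \<le> (\<Sum>j\<in>J. (cmod (cinner x (u j)))\<^sup>2 * (2 - (norm (u j))\<^sup>2))"
  proof (rule sum_mono)
    fix j assume "j \<in> J"
    then have "(norm (u j))\<^sup>2 \<le> 1"
      using assms by (simp add: suborthonormal_def power_le_one)
    then show "(cmod (cinner x (u j)))\<^sup>2 \<le> (cmod (cinner x (u j)))\<^sup>2 * (2 - (norm (u j))\<^sup>2)"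
      using mult_left_mono[of 1 "2 - (norm (u j))\<^sup>2" "(cmod (cinner x (u j)))\<^sup>2"] by simp
  qed
  moreover have "0 \<le> (norm x)\<^sup>2 - (\<Sum>j\<in>J. (cmod (cinner x (u j)))\<^sup>2 * (2 - (norm (u j))\<^sup>2))"
    using norm_diff_projection[OF assms, of x] zero_le_power2 by metis
  ultimately show ?thesis by simp
qed

text \<open>Pairing the coefficients of \<open>x\<close> and \<open>y\<close> in two families by Cauchy--Schwarz.\<close>

lemma Bessel_inequality_product:
  assumes "finite J" "suborthonormal J u" "suborthonormal J v"
  shows "(\<Sum>j\<in>J. cmod (cinner x (u j)) * cmod (cinner y (v j))) \<le> norm x * norm y"
proof -
  have "(\<Sum>j\<in>J. cmod (cinner x (u j)) * cmod (cinner y (v j)))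
      \<le> L2_set (\<lambda>j. cmod (cinner x (u j))) J * L2_set (\<lambda>j. cmod (cinner y (v j))) J"
    using L2_set_mult_ineq[of "\<lambda>j. cmod (cinner x (u j))" "\<lambda>j. cmod (cinner y (v j))" J] by simp
  also have "\<dots> \<le> norm x * norm y"
    unfolding L2_set_def
    by (intro mult_mono real_le_lsqrt Bessel_inequality assms real_sqrt_ge_zero sum_nonneg) auto
  finally show ?thesis .
qed

section \<open>Compact operators and their adjoints\<close>

lemma complex_linear_iff:
  "Vector_Spaces.linear scaleC scaleC A \<longleftrightarrow>
    (\<forall>x y. A (x + y) = A x + A y) \<and> (\<forall>c x. A (c *\<^sub>C x) = c *\<^sub>C A x)"
  unfolding Vector_Spaces.linear_def module_hom_def module_hom_axioms_def
  by (auto intro: ell2.vector_space_axioms ell2.module_axioms)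

lemma compact_operator_scaleC: "compact_operator A \<Longrightarrow> A (c *\<^sub>C x) = c *\<^sub>C A x"
  by (simp add: compact_operator_def complex_linear_iff)

lemma compact_operator_bounded_linear:
  assumes "compact_operator A"
  shows "bounded_linear A"
proof -
  have lin: "A (x + y) = A x + A y" "A (c *\<^sub>C x) = c *\<^sub>C A x" for x y c
    using assms by (simp_all add: compact_operator_def complex_linear_iff)
  have "bounded (A ` cball 0 1)"
    using assms by (meson bounded_subset closure_subset compact_imp_bounded compact_operator_def)
  then obtain C where C: "\<And>x. norm x \<le> 1 \<Longrightarrow> norm (A x) \<le> C"
    unfolding bounded_iff by (metis imageI mem_cball_0)
  show ?thesis
  proof (rule bounded_linear_intro[where K = C])
    fix x
    show "norm (A x) \<le> norm x * C"
    proof (cases "x = 0")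
      case True
      then show ?thesis
        using lin(2)[of 0 0] norm_scaleC[of 0 "A 0"] norm_scaleC[of 0 0] by simp
    next
      case False
      have "A x = A (of_real (norm x) *\<^sub>C (inverse (norm x) *\<^sub>R x))"
        using False by (simp add: scaleR_ell2_def[symmetric])
      also have "norm \<dots> = norm x * norm (A (inverse (norm x) *\<^sub>R x))"
        by (simp only: lin norm_scaleC) simp
      also have "\<dots> \<le> norm x * C"
        using False by (intro mult_left_mono C) simp_all
      finally show ?thesis .
    qed
  qed (simp_all add: lin scaleR_ell2_def)
qed

lemma compact_operatorI:
  assumes "\<And>x y. A (x + y) = A x + A y" "\<And>c x. A (c *\<^sub>C x) = c *\<^sub>C A x"
    and "compact K" "\<And>x. norm x \<le> 1 \<Longrightarrow> A x \<in> K"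
  shows "compact_operator A"
  unfolding compact_operator_def complex_linear_iff
proof (intro conjI allI assms(1,2))
  have "closure (A ` cball 0 1) \<subseteq> K"
    using assms(3,4) by (intro closure_minimal) (auto intro: compact_imp_closed)
  then show "compact (closure (A ` cball 0 1))"
    using compact_Int_closed[OF assms(3) closed_closure, of "A ` cball 0 1"]
    by (simp add: Int_absorb1)
qed

lemma compact_operator_add:
  assumes "compact_operator A" "compact_operator B"
  shows "compact_operator (\<lambda>x. A x + B x)"
proof (rule compact_operatorI)
  show "compact {x + y |x y. x \<in> closure (A ` cball 0 1) \<and> y \<in> closure (B ` cball 0 1)}"
    using assms by (intro compact_sums) (simp_all add: compact_operator_def)
  show "A x + B x \<in> {x + y |x y. x \<in> closure (A ` cball 0 1) \<and> y \<in> closure (B ` cball 0 1)}"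
    if "norm x \<le> 1" for x
  proof -
    have "A x \<in> closure (A ` cball 0 1)" "B x \<in> closure (B ` cball 0 1)"
      using that closure_subset by (force)+
    then show ?thesis by blast
  qed
  show "A (x + y) + B (x + y) = (A x + B x) + (A y + B y)" for x y
    using assms by (simp add: compact_operator_def complex_linear_iff algebra_simps)
  show "A (c *\<^sub>C x) + B (c *\<^sub>C x) = c *\<^sub>C (A x + B x)" for c x
    using assms by (simp add: compact_operator_scaleC ell2.scale_right_distrib)
qed

lemma continuous_on_scaleC: "continuous_on S (\<lambda>x. c *\<^sub>C x)"
proof -
  have "bounded_linear ((*\<^sub>C) c)"
    by (rule bounded_linear_intro[where K = "cmod c"])
      (simp_all add: ell2.scale_right_distrib scaleR_ell2_def norm_scaleC mult.commute)
  then show ?thesis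
    by (rule linear_continuous_on)
qed

lemma compact_operator_scale:
  assumes "compact_operator A"
  shows "compact_operator (\<lambda>x. c *\<^sub>C A x)"
proof (rule compact_operatorI)
  show "compact ((*\<^sub>C) c ` closure (A ` cball 0 1))"
    using assms by (intro compact_continuous_image continuous_on_scaleC) (simp add: compact_operator_def)
  show "c *\<^sub>C A x \<in> (*\<^sub>C) c ` closure (A ` cball 0 1)" if "norm x \<le> 1" for x
    using that closure_subset by force
  show "c *\<^sub>C A (x + y) = c *\<^sub>C A x + c *\<^sub>C A y" for x y
    using assms by (simp add: compact_operator_def complex_linear_iff ell2.scale_right_distrib)
  show "c *\<^sub>C A (d *\<^sub>C x) = d *\<^sub>C (c *\<^sub>C A x)" for d x
    using assms by (simp add: compact_operator_scaleC mult.commute)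
qed

text \<open>
  The coordinates of the adjoint are forced; they are square-summable because the truncations \<open>z\<close>
  satisfy \<open>\<parallel>z\<parallel>\<^sup>2 = \<langle>A z, y\<rangle>\<close>, so \<open>\<parallel>z\<parallel> \<le> \<parallel>A\<parallel> \<parallel>y\<parallel>\<close>.
\<close>

lemma adjoint_exists:
  assumes "compact_operator A"
  shows "\<exists>B. \<forall>x y. cinner (A x) y = cinner x (B y)"
proof -
  interpret A: bounded_linear A
    by (rule compact_operator_bounded_linear[OF assms])
  obtain C where C: "\<And>x. norm (A x) \<le> norm x * C" and "0 < C"
    using A.pos_bounded by blast
  have "\<exists>b. \<forall>x. cinner (A x) y = cinner x b" for y
  proof -
    define g where "g n = cinner y (A (basis n))" for n
    define z where "z N = (\<Sum>n<N. g n *\<^sub>C basis n)" for N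
    have b0: "basis 0 = 0"
      by (rule ell2_eqI) (simp add: coord_basis zero_ell2.rep_eq)
    have cz: "coord (z N) k = (if k < N then g k else 0)" for N k
    proof -
      have "coord (z N) k = (\<Sum>n<N. if n = k then g k else 0)"
        unfolding z_def coord_sum
        by (intro sum.cong) (auto simp: scaleC.rep_eq coord_basis g_def b0 A.zero not_le cinner.zero_right)
      then show ?thesis by simp
    qed
    have zz: "cinner (A x) y = cinner x (z N)" if "x = (\<Sum>n<N. c n *\<^sub>C basis n)" for x c N
    proof -
      have "cinner (A x) y = (\<Sum>n<N. c n * cinner (A (basis n)) y)"
        by (simp add: that A.sum cinner.sum_left cinner_scaleC_left compact_operator_scaleC[OF assms])
      also have "\<dots> = (\<Sum>n<N. c n * cinner (basis n) (z N))"
        by (intro sum.cong refl) (simp add: cinner_basis_left cz g_def cnj_cinner)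
      finally show ?thesis
        by (simp add: that cinner.sum_left cinner_scaleC_left)
    qed
    have zb: "norm (z N) \<le> C * norm y" for N
    proof -
      have "(norm (z N))\<^sup>2 = cmod (cinner (A (z N)) y)"
        unfolding zz[OF z_def] cinner_self by (simp add: norm_power)
      also have "\<dots> \<le> norm (A (z N)) * norm y"
        by (rule cmod_cinner_le)
      also have "\<dots> \<le> (norm (z N) * C) * norm y"
        by (intro mult_right_mono C norm_ge_zero)
      finally have "norm (z N) * norm (z N) \<le> norm (z N) * (C * norm y)"
        by (simp add: power2_eq_square mult_ac)
      then show ?thesis
        using \<open>0 < C\<close> by (cases "z N = 0") auto
    qed
    have "summable (\<lambda>n. (cmod (g n))\<^sup>2)"
    proof (rule summableI_nonneg_bounded)
      fix N
      have "(norm (z N))\<^sup>2 = (\<Sum>n<N. (cmod (g n))\<^sup>2)"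
      proof -
        have "(\<lambda>k. (cmod (coord (z N) k))\<^sup>2) sums (\<Sum>n<N. (cmod (coord (z N) n))\<^sup>2)"
          by (rule sums_finite) (auto simp: cz)
        moreover have "(norm (z N))\<^sup>2 = (\<Sum>k. (cmod (coord (z N) k))\<^sup>2)"
          by (simp add: norm_ell2_def suminf_nonneg[OF summable_coord_power2])
        ultimately show ?thesis
          by (simp add: sums_iff cz)
      qed
      then show "(\<Sum>n<N. (cmod (g n))\<^sup>2) \<le> (C * norm y)\<^sup>2"
        using power_mono[OF zb, of N 2] by simp
    qed simp
    moreover have "g 0 = 0"
      by (simp add: g_def b0 A.zero cinner.zero_right)
    ultimately have g: "coord (Abs_ell2 g) = g"
      by (simp add: Abs_ell2_inverse)
    have "cinner (A x) y = cinner x (Abs_ell2 g)" for x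
    proof -
      let ?x = "\<lambda>N. \<Sum>n<N. coord x n *\<^sub>C basis n"
      have "cinner (A (?x N)) y = cinner (?x N) (Abs_ell2 g)" for N
        unfolding zz[OF refl] unfolding cinner.sum_left cinner_scaleC_left
        by (intro sum.cong refl) (simp add: cinner_basis_left cz g)
      moreover have "(\<lambda>N. cinner (A (?x N)) y) \<longlonglongrightarrow> cinner (A x) y"
        by (intro cinner.tendsto A.tendsto finite_basis_expansion_tendsto tendsto_const)
      moreover have "(\<lambda>N. cinner (?x N) (Abs_ell2 g)) \<longlonglongrightarrow> cinner x (Abs_ell2 g)"
        by (intro cinner.tendsto finite_basis_expansion_tendsto tendsto_const)
      ultimately show ?thesis
        using LIMSEQ_unique by simp
    qed
    then show ?thesis by blast
  qed
  then show ?thesis by metis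
qed

lemma cinner_hilbert_adjoint:
  assumes "compact_operator A"
  shows "cinner (A x) y = cinner x (hilbert_adjoint A y)"
proof -
  obtain B where B: "\<forall>x y. cinner (A x) y = cinner x (B y)"
    using adjoint_exists[OF assms] by blast
  have "\<exists>!B. \<forall>x y. cinner (A x) y = cinner x (B y)"
  proof (rule ex1I[of _ B])
    fix B' assume B': "\<forall>x y. cinner (A x) y = cinner x (B' y)"
    show "B' = B"
    proof (rule ext, rule ell2_cinner_eqI)
      show "cinner (B' y) z = cinner (B y) z" for y z
        using cnj_cinner[of z "B' y"] cnj_cinner[of z "B y"] B B' by simp
    qed
  qed (rule B)
  from theI'[OF this] show ?thesis
    unfolding hilbert_adjoint_def by blast
qed

lemma bounded_linear_hilbert_adjoint:
  assumes "compact_operator A"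
  shows "bounded_linear (hilbert_adjoint A)"
proof -
  interpret A: bounded_linear A
    by (rule compact_operator_bounded_linear[OF assms])
  obtain C where C: "\<And>x. norm (A x) \<le> norm x * C" and "0 < C"
    using A.pos_bounded by blast
  have adj: "cinner (hilbert_adjoint A y) x = cinner y (A x)" for x y
    by (metis cinner_hilbert_adjoint[OF assms] cnj_cinner)
  show ?thesis
  proof (rule bounded_linear_intro[where K = C])
    show "hilbert_adjoint A (x + y) = hilbert_adjoint A x + hilbert_adjoint A y" for x y
      by (rule ell2_cinner_eqI) (simp add: cinner_add_left adj)
    show "hilbert_adjoint A (r *\<^sub>R x) = r *\<^sub>R hilbert_adjoint A x" for r x
      by (rule ell2_cinner_eqI) (simp add: cinner.scaleR_left adj)
    fix y
    let ?b = "hilbert_adjoint A y"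
    have "(norm ?b)\<^sup>2 = cmod (cinner y (A ?b))"
      by (simp add: adj[symmetric] cinner_self norm_power)
    also have "\<dots> \<le> norm y * norm (A ?b)"
      by (rule cmod_cinner_le)
    also have "\<dots> \<le> norm y * (norm ?b * C)"
      by (intro mult_left_mono C norm_ge_zero)
    finally have "norm ?b * norm ?b \<le> norm ?b * (norm y * C)"
      by (simp add: power2_eq_square mult_ac)
    then show "norm ?b \<le> norm y * C"
      using \<open>0 < C\<close> by (cases "?b = 0") auto
  qed
qed

lemma cinner_adjoint_self_left:
  assumes "compact_operator A"
  shows "cinner (hilbert_adjoint A (A x)) y = cinner (A x) (A y)"
  by (metis cinner_hilbert_adjoint[OF assms] cnj_cinner)

section \<open>The Schmidt decomposition of a compact operator\<close>

text \<open>
  A maximising sequence \<open>x\<^sub>n\<close> for \<open>S = sup \<parallel>A x\<parallel>\<close> over the unit ball of \<open>V\<close> satisfies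
  \<open>A\<^sup>* A x\<^sub>n - S\<^sup>2 x\<^sub>n \<rightarrow> 0\<close>; compactness of \<open>A\<close> makes \<open>A\<^sup>* A x\<^sub>n\<close> converge along a subsequence, and with it
  \<open>x\<^sub>n\<close>. The zero vector is the maximiser if \<open>A\<close> vanishes on \<open>V\<close>.
\<close>

lemma maximising_eigenvector_exists:
  fixes A :: "ell2 \<Rightarrow> ell2"
  defines "T \<equiv> \<lambda>x. hilbert_adjoint A (A x)"
  assumes A: "compact_operator A" and V: "subspace V" "closed V" "\<And>x. x \<in> V \<Longrightarrow> T x \<in> V"
  shows "\<exists>e\<in>V. (e = 0 \<or> norm e = 1) \<and> (A e = 0 \<longrightarrow> e = 0) \<and> T e = (norm (A e))\<^sup>2 *\<^sub>R e \<and>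
    (\<forall>x\<in>V. norm (A x) \<le> norm (A e) * norm x)"
proof -
  interpret A: bounded_linear A
    by (rule compact_operator_bounded_linear[OF A])
  interpret As: bounded_linear "hilbert_adjoint A"
    by (rule bounded_linear_hilbert_adjoint[OF A])
  obtain C where C: "\<And>x. norm (A x) \<le> norm x * C" "0 < C"
    using A.pos_bounded by blast
  define U where "U = V \<inter> cball 0 1"
  define S where "S = (SUP x\<in>U. norm (A x))"
  have "0 \<in> U"
    using V(1) by (simp add: U_def subspace_0)
  have bdd: "bdd_above ((\<lambda>x. norm (A x)) ` U)"
  proof (rule bdd_aboveI2)
    fix x assume "x \<in> U"
    then have "norm x * C \<le> 1 * C"
      using C by (intro mult_right_mono) (auto simp: U_def)
    then show "norm (A x) \<le> C"
      using C(1)[of x] by simp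
  qed
  have US: "norm (A x) \<le> S" if "x \<in> U" for x
    unfolding S_def by (rule cSUP_upper[OF that bdd])
  have VS: "norm (A x) \<le> S * norm x" if "x \<in> V" for x
  proof (cases "x = 0")
    case False
    then have "inverse (norm x) *\<^sub>R x \<in> U"
      using that V(1) by (simp add: U_def subspace_scale)
    from US[OF this] show ?thesis
      using False by (simp add: A.scaleR field_simps)
  qed (simp add: A.zero)
  have "0 \<le> S"
    using US[OF \<open>0 \<in> U\<close>] by (simp add: A.zero)
  show ?thesis
  proof (cases "S = 0")
    case True
    then show ?thesis
      using VS V(1) by (intro bexI[of _ 0]) (auto simp: T_def A.zero As.zero subspace_0)
  next
    case False
    with \<open>0 \<le> S\<close> have S: "0 < S" by simp
    have "\<exists>x\<in>U. S - inverse (real (Suc n)) < norm (A x)" for n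
      using less_cSUP_iff[OF _ bdd, of "S - inverse (real (Suc n))"] \<open>0 \<in> U\<close>
      unfolding S_def[symmetric] by auto
    then obtain x where xU: "\<And>n. x n \<in> U" and xS: "\<And>n. S - inverse (real (Suc n)) < norm (A (x n))"
      by metis
    have limS: "(\<lambda>n. norm (A (x n))) \<longlonglongrightarrow> S"
    proof (rule tendsto_sandwich)
      show "(\<lambda>n. S - inverse (real (Suc n))) \<longlonglongrightarrow> S"
        using tendsto_diff[OF tendsto_const LIMSEQ_inverse_real_of_nat, of S] by simp
      show "(\<lambda>n. S) \<longlonglongrightarrow> S" by simp
    qed (use xS US[OF xU] in \<open>auto intro!: always_eventually less_imp_le\<close>)
    have "seq_compact (closure (A ` cball 0 1))"
      using A by (intro compact_imp_seq_compact) (simp add: compact_operator_def)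
    moreover have "\<forall>n. A (x n) \<in> closure (A ` cball 0 1)"
      using xU closure_subset unfolding U_def by blast
    ultimately obtain l r where r: "strict_mono (r :: nat \<Rightarrow> nat)" and "(\<lambda>n. A (x (r n))) \<longlonglongrightarrow> l"
      by (auto elim!: seq_compactE simp: comp_def)
    then have limT: "(\<lambda>n. T (x (r n))) \<longlonglongrightarrow> hilbert_adjoint A l"
      unfolding T_def by (intro As.tendsto)
    define e where "e = inverse (S\<^sup>2) *\<^sub>R hilbert_adjoint A l"
    have bound: "(norm (T y - S\<^sup>2 *\<^sub>R y))\<^sup>2 \<le> 2 * S ^ 4 - 2 * S\<^sup>2 * (norm (A y))\<^sup>2" if "y \<in> U" for y
    proof -
      have y: "y \<in> V" "norm y \<le> 1"
        using that by (auto simp: U_def)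
      have TT: "inner (T y) (T y) \<le> S ^ 4"
      proof -
        have "norm (T y) * norm (T y) = cmod (cinner (T y) (T y))"
          by (simp add: cinner_self power2_eq_square norm_mult)
        also have "\<dots> = cmod (cinner (A y) (A (T y)))"
          by (metis T_def cinner_adjoint_self_left[OF A])
        also have "\<dots> \<le> norm (A y) * norm (A (T y))"
          by (rule cmod_cinner_le)
        also have "\<dots> \<le> S * (S * norm (T y))"
          using S by (intro mult_mono US VS V(3) y that) auto
        finally have "norm (T y) * norm (T y) \<le> norm (T y) * S\<^sup>2"
          by (simp add: power2_eq_square mult_ac)
        then have "norm (T y) \<le> S\<^sup>2"
          by (cases "T y = 0") auto
        then have "(norm (T y))\<^sup>2 \<le> (S\<^sup>2)\<^sup>2"
          by (intro power_mono) auto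
        then show ?thesis
          by (simp add: power2_norm_eq_inner)
      qed
      have Ty: "inner (T y) y = (norm (A y))\<^sup>2"
        by (simp add: inner_ell2_def T_def cinner_adjoint_self_left[OF A] cinner_self)
      have "(norm (T y - S\<^sup>2 *\<^sub>R y))\<^sup>2 = inner (T y) (T y) - 2 * S\<^sup>2 * (norm (A y))\<^sup>2 + S ^ 4 * (norm y)\<^sup>2"
      proof -
        have "(norm (T y - S\<^sup>2 *\<^sub>R y))\<^sup>2
            = inner (T y) (T y) - 2 * S\<^sup>2 * inner (T y) y + (S\<^sup>2)\<^sup>2 * inner y y"
          unfolding power2_norm_eq_inner
          by (simp add: inner_diff_left inner_diff_right inner_commute[of y "T y"] power2_eq_square
              right_diff_distrib)
        then show ?thesis
          by (simp add: Ty power2_norm_eq_inner)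
      qed
      also have "\<dots> \<le> S ^ 4 - 2 * S\<^sup>2 * (norm (A y))\<^sup>2 + S ^ 4 * 1"
        using y TT by (intro add_mono diff_mono mult_left_mono) (auto simp: power_le_one)
      finally show ?thesis by simp
    qed
    have "(\<lambda>n. 2 * S ^ 4 - 2 * S\<^sup>2 * (norm (A (x (r n))))\<^sup>2) \<longlonglongrightarrow> 2 * S ^ 4 - 2 * S\<^sup>2 * S\<^sup>2"
      using LIMSEQ_subseq_LIMSEQ[OF limS r] unfolding comp_def by (intro tendsto_intros)
    then have "(\<lambda>n. 2 * S ^ 4 - 2 * S\<^sup>2 * (norm (A (x (r n))))\<^sup>2) \<longlonglongrightarrow> 0"
      by (simp add: power4_eq_xxxx power2_eq_square)
    then have "(\<lambda>n. (norm (T (x (r n)) - S\<^sup>2 *\<^sub>R x (r n)))\<^sup>2) \<longlonglongrightarrow> 0"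
      by (rule Lim_null_comparison[rotated]) (auto intro!: always_eventually bound xU)
    then have "(\<lambda>n. sqrt ((norm (T (x (r n)) - S\<^sup>2 *\<^sub>R x (r n)))\<^sup>2)) \<longlonglongrightarrow> sqrt 0"
      by (rule tendsto_real_sqrt)
    then have "(\<lambda>n. T (x (r n)) - S\<^sup>2 *\<^sub>R x (r n)) \<longlonglongrightarrow> 0"
      by (simp add: tendsto_norm_zero_iff)
    from tendsto_diff[OF limT this] have "(\<lambda>n. S\<^sup>2 *\<^sub>R x (r n)) \<longlonglongrightarrow> hilbert_adjoint A l"
      by simp
    from tendsto_scaleR[OF tendsto_const[of "inverse (S\<^sup>2)"] this]
    have lime: "(\<lambda>n. x (r n)) \<longlonglongrightarrow> e"
      using S by (simp add: e_def)
    have "closed U"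
      unfolding U_def by (intro closed_Int V) simp
    then have "e \<in> U"
      using closed_sequentially[OF _ _ lime] xU by simp
    have Ae: "norm (A e) = S"
      using tendsto_norm[OF A.tendsto[OF lime]] LIMSEQ_subseq_LIMSEQ[OF limS r]
      unfolding comp_def by (rule LIMSEQ_unique)
    have "T e = hilbert_adjoint A l"
      using As.tendsto[OF A.tendsto[OF lime]] limT unfolding T_def by (rule LIMSEQ_unique)
    then have "T e = (norm (A e))\<^sup>2 *\<^sub>R e"
      unfolding Ae using S by (simp add: e_def)
    moreover have "norm e = 1"
    proof (rule antisym)
      show "norm e \<le> 1" using \<open>e \<in> U\<close> by (simp add: U_def)
      have "S \<le> S * norm e"
        using VS[of e] \<open>e \<in> U\<close> Ae by (simp add: U_def)
      then show "1 \<le> norm e" using S by simp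
    qed
    moreover have "e \<in> V"
      using \<open>e \<in> U\<close> by (simp add: U_def)
    ultimately show ?thesis
      using VS Ae S by (intro bexI[of _ e]) auto
  qed
qed

lemma orthonormal_independent:
  assumes "finite K" and "\<And>i j. i \<in> K \<Longrightarrow> j \<in> K \<Longrightarrow> cinner (e i) (e j) = (if i = j then 1 else 0)"
  shows "inj_on e K" "ell2.independent (e ` K)"
proof -
  show inj: "inj_on e K"
  proof (rule inj_onI)
    fix i j assume "i \<in> K" "j \<in> K" "e i = e j"
    then show "i = j"
      using assms(2)[of i j] assms(2)[of j j] by (auto split: if_splits)
  qed
  have "u (e j) = 0" if sum0: "(\<Sum>v\<in>e ` K. u v *\<^sub>C v) = 0" and j: "j \<in> K" for u j
  proof -
    have "(\<Sum>i\<in>K. u (e i) *\<^sub>C e i) = 0"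
      using sum0 inj by (simp add: sum.reindex)
    then have "0 = cinner (\<Sum>i\<in>K. u (e i) *\<^sub>C e i) (e j)"
      by (simp add: cinner.zero_left)
    also have "\<dots> = (\<Sum>i\<in>K. if i = j then u (e j) else 0)"
      unfolding cinner.sum_left cinner_scaleC_left
      using j by (intro sum.cong) (auto simp: assms(2))
    finally show ?thesis
      using assms(1) j by simp
  qed
  then show "ell2.independent (e ` K)"
    using assms(1) by (auto simp: ell2.dependent_finite)
qed

text \<open>
  Two nonincreasing null sequences with the same multiplicities have the same number of terms above
  every positive level, and a nonincreasing sequence is determined by these numbers.
\<close>

lemma decseq_eqI_level_cards:
  fixes s t :: "nat \<Rightarrow> real"
  assumes "decseq s" "decseq t" "s \<longlonglongrightarrow> 0" "t \<longlonglongrightarrow> 0"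
    and "\<And>k. 0 \<le> s k" "\<And>k. 0 \<le> t k"
    and "\<And>\<mu>. 0 < \<mu> \<Longrightarrow> card {k. s k = \<mu>} = card {k. t k = \<mu>}"
  shows "s = t"
proof -
  have fin: "finite {k. \<mu> < u k}" if "u \<longlonglongrightarrow> 0" "0 < \<mu>" for u :: "nat \<Rightarrow> real" and \<mu>
  proof -
    from order_tendstoD(2)[OF that] obtain N where "\<And>k. k \<ge> N \<Longrightarrow> u k < \<mu>"
      unfolding eventually_sequentially by blast
    then have "{k. \<mu> < u k} \<subseteq> {..<N}"
      by (metis (mono_tags) lessThan_iff mem_Collect_eq not_less not_less_iff_gr_or_eq subsetI)
    then show ?thesis
      by (rule finite_subset) simp
  qed
  have count: "card {k. \<mu> < s k} = card {k. \<mu> < t k}" if \<mu>: "0 < \<mu>" for \<mu>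
  proof -
    define W where "W = s ` {k. \<mu> < s k} \<union> t ` {k. \<mu> < t k}"
    have W: "finite W" "\<And>\<nu>. \<nu> \<in> W \<Longrightarrow> \<mu> < \<nu>"
      using assms fin \<mu> by (auto simp: W_def)
    have split: "card {k. \<mu> < u k} = (\<Sum>\<nu>\<in>W. card {k. u k = \<nu>})"
      if u: "u \<longlonglongrightarrow> 0" and uW: "u ` {k. \<mu> < u k} \<subseteq> W" for u :: "nat \<Rightarrow> real"
    proof -
      have "{k. \<mu> < u k} = (\<Union>\<nu>\<in>W. {k. u k = \<nu>})"
        using uW W by auto
      also have "card \<dots> = (\<Sum>\<nu>\<in>W. card {k. u k = \<nu>})"
      proof (rule card_UN_disjoint)
        show "\<forall>\<nu>\<in>W. finite {k. u k = \<nu>}"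
        proof
          fix \<nu> assume "\<nu> \<in> W"
          then have "{k. u k = \<nu>} \<subseteq> {k. \<mu> < u k}"
            using W by auto
          then show "finite {k. u k = \<nu>}"
            using fin[OF u \<mu>] by (rule finite_subset)
        qed
      qed (use W in auto)
      finally show ?thesis .
    qed
    have "card {k. \<mu> < s k} = (\<Sum>\<nu>\<in>W. card {k. s k = \<nu>})"
      by (rule split[OF assms(3)]) (simp add: W_def)
    also have "\<dots> = (\<Sum>\<nu>\<in>W. card {k. t k = \<nu>})"
      using W(2) \<mu> by (intro sum.cong refl assms(7)) force
    also have "\<dots> = card {k. \<mu> < t k}"
      by (rule split[OF assms(4), symmetric]) (simp add: W_def)
    finally show ?thesis .
  qed
  have initial: "\<mu> < u k \<longleftrightarrow> k < card {k. \<mu> < u k}"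
    if u: "decseq u" "u \<longlonglongrightarrow> 0" and "0 < \<mu>" for u :: "nat \<Rightarrow> real" and \<mu> k
  proof -
    define N where "N = (LEAST n. \<not> \<mu> < u n)"
    have "\<exists>n. \<not> \<mu> < u n"
      using fin[OF u(2) \<open>0 < \<mu>\<close>] by (metis (mono_tags, lifting) UNIV_eq_I infinite_UNIV_nat mem_Collect_eq)
    then have "\<not> \<mu> < u N"
      unfolding N_def by (rule LeastI_ex)
    have "{k. \<mu> < u k} = {..<N}"
    proof (intro set_eqI iffI)
      fix k assume "k \<in> {k. \<mu> < u k}"
      then show "k \<in> {..<N}"
        using \<open>\<not> \<mu> < u N\<close> decseqD[OF u(1), of N k] by (force simp: not_le[symmetric])
    next
      fix k assume "k \<in> {..<N}"
      then show "k \<in> {k. \<mu> < u k}"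
        using not_less_Least[of k "\<lambda>n. \<not> \<mu> < u n"] by (simp add: N_def)
    qed
    then show ?thesis by auto
  qed
  have level: "\<mu> < s k \<longleftrightarrow> \<mu> < t k" if "0 < \<mu>" for \<mu> k
    using initial[OF assms(1,3) that, of k] initial[OF assms(2,4) that, of k] count[OF that] by simp
  have "\<not> s k < t k" "\<not> t k < s k" for k
    using level[of "(s k + t k) / 2" k] assms(5,6)[of k] by (auto simp: field_simps)
  then show ?thesis
    by (intro ext) (meson linorder_neqE)
qed

text \<open>
  The \<open>e\<^sub>k\<close> are constructed by maximising \<open>\<parallel>A x\<parallel>\<close> over the unit ball of the orthogonal complement of
  \<open>e\<^sub>0, \<dots>, e\<^bsub>k-1\<^esub>\<close>. Consequently \<open>A\<close> is bounded by \<open>s\<^sub>k\<close> on that complement, which is the estimate for the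
  remainder of the expansion.
\<close>

theorem Schmidt_decomposition:
  assumes A: "compact_operator A"
  obtains e f where
    "is_singular_value_sequence A (singular_value A)"
    "suborthonormal UNIV e" "suborthonormal UNIV f"
    "\<And>k. A (e k) = of_real (singular_value A k) *\<^sub>C f k"
    "\<And>k. cinner (A (e k)) (f k) = of_real (singular_value A k)"
    "\<And>K x. norm (A x - (\<Sum>k<K. (of_real (singular_value A k) * cinner x (e k)) *\<^sub>C f k))
      \<le> singular_value A K * norm x"
proof -
  interpret A: bounded_linear A
    by (rule compact_operator_bounded_linear[OF A])
  interpret As: bounded_linear "hilbert_adjoint A"
    by (rule bounded_linear_hilbert_adjoint[OF A])
  define T where "T x = hilbert_adjoint A (A x)" for x
  define V where "V g k = {x. \<forall>i<k. cinner x (g i) = 0}" for g :: "nat \<Rightarrow> ell2" and k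
  define P where "P g k r \<longleftrightarrow> r \<in> V g k \<and>
      (r = 0 \<or> norm r = 1) \<and> (A r = 0 \<longrightarrow> r = 0) \<and>
      T r = (norm (A r))\<^sup>2 *\<^sub>R r \<and> (\<forall>x\<in>V g k. norm (A x) \<le> norm (A r) * norm x)" for g :: "nat \<Rightarrow> ell2" and k r
  have T_sym: "cinner (T x) y = cinner x (T y)" for x y
    unfolding T_def cinner_adjoint_self_left[OF A] by (rule cinner_hilbert_adjoint[OF A])
  have "\<exists>e. \<forall>k. P e k (e k)"
  proof (rule dependent_wellorder_choice)
    fix r :: ell2 and g h :: "nat \<Rightarrow> ell2" and k :: nat assume "\<And>y. y < k \<Longrightarrow> g y = h y"
    then have "V g k = V h k" by (simp add: V_def)
    then show "P g k r = P h k r" by (simp add: P_def)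
  next
    fix k :: nat and g :: "nat \<Rightarrow> ell2" assume IH: "\<And>y. y < k \<Longrightarrow> P g y (g y)"
    have "\<exists>e\<in>V g k. (e = 0 \<or> norm e = 1) \<and> (A e = 0 \<longrightarrow> e = 0) \<and>
        hilbert_adjoint A (A e) = (norm (A e))\<^sup>2 *\<^sub>R e \<and> (\<forall>x\<in>V g k. norm (A x) \<le> norm (A e) * norm x)"
    proof (rule maximising_eigenvector_exists[OF A])
      show "subspace (V g k)"
        by (auto simp: subspace_def V_def cinner.zero_left cinner_add_left cinner.scaleR_left)
      have "V g k = (\<Inter>i\<in>{..<k}. {x. cinner x (g i) = 0})"
        by (auto simp: V_def)
      also have "closed \<dots>"
        by (intro closed_INT ballI closed_Collect_eq continuous_intros cinner.continuous_on)
      finally show "closed (V g k)" .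
      fix x assume x: "x \<in> V g k"
      have "cinner (T x) (g i) = 0" if "i < k" for i
        using x IH[OF that] that unfolding T_sym by (simp add: P_def cinner.scaleR_right V_def)
      then show "hilbert_adjoint A (A x) \<in> V g k"
        by (simp add: V_def T_def)
    qed
    then show "\<exists>r. P g k r"
      unfolding P_def T_def by blast
  qed
  then obtain e where e: "\<And>k. P e k (e k)" by blast
  \<comment> \<open>if \<open>s k = 0\<close>, the default \<open>inverse 0 = 0\<close> makes \<open>f k\<close> the zero vector\<close>
  define s where "s k = norm (A (e k))" for k
  define f where "f k = inverse (s k) *\<^sub>R A (e k)" for k
  have e01: "e k = 0 \<or> norm (e k) = 1" and Te: "T (e k) = (s k)\<^sup>2 *\<^sub>R e k"
    and emax: "\<And>x. x \<in> V e k \<Longrightarrow> norm (A x) \<le> s k * norm x" for k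
    using e[of k] by (auto simp: P_def s_def)
  have orth: "cinner (e i) (e j) = 0" if "i \<noteq> j" for i j
  proof -
    have "cinner (e j) (e i) = 0" if "i < j" for i j
      using e[of j] that by (simp add: P_def V_def)
    then show ?thesis
      using that by (cases "i < j") (auto simp: cinner_commute_zero[of "e i" "e j"])
  qed
  have enorm: "norm (e k) = 1" if "0 < s k" for k
    using e01[of k] that by (auto simp: s_def A.zero)
  have sub_e: "suborthonormal UNIV e"
    unfolding suborthonormal_def using e01 orth by (metis norm_zero order_refl zero_le_one)
  have AeAe: "cinner (A (e i)) (A (e j)) = 0" if "i \<noteq> j" for i j
    using orth[OF that] by (simp add: cinner_hilbert_adjoint[OF A] T_def[symmetric] Te cinner.scaleR_right)
  have s_nonneg: "0 \<le> s k" for k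
    by (simp add: s_def)
  have sub_f: "suborthonormal UNIV f"
    unfolding suborthonormal_def f_def
  proof (intro conjI ballI impI)
    show "norm (inverse (s i) *\<^sub>R A (e i)) \<le> 1" for i
      by (cases "s i = 0") (simp_all add: s_def)
  qed (simp add: cinner.scaleR_left cinner.scaleR_right AeAe)
  have Aef: "A (e k) = of_real (s k) *\<^sub>C f k" for k
    by (cases "s k = 0") (auto simp: f_def scaleR_ell2_def[symmetric] s_def)
  have Aeff: "cinner (A (e k)) (f k) = of_real (s k)" for k
    by (cases "s k = 0")
      (auto simp: f_def cinner.scaleR_right cinner_self s_def[symmetric] power2_eq_square
        scaleR_conv_of_real)
  have dec: "decseq s"
  proof (rule decseq_SucI)
    fix k
    have "e (Suc k) \<in> V e k"
      by (simp add: V_def orth)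
    from emax[OF this] have "s (Suc k) \<le> s k * norm (e (Suc k))"
      by (simp add: s_def)
    also have "\<dots> \<le> s k * 1"
      using e01[of "Suc k"] by (intro mult_left_mono s_nonneg) auto
    finally show "s (Suc k) \<le> s k" by simp
  qed
  have lim: "s \<longlonglongrightarrow> 0"
  proof -
    obtain L where L: "s \<longlonglongrightarrow> L" "\<And>k. L \<le> s k"
      using decseq_convergent[OF dec, of 0] s_nonneg by blast
    have "0 \<le> L"
      using LIMSEQ_le_const[OF L(1), of 0] s_nonneg by blast
    have "L = 0"
    proof (rule ccontr)
      assume "L \<noteq> 0"
      then have "0 < L" using \<open>0 \<le> L\<close> by simp
      have "seq_compact (closure (A ` cball 0 1))"
        using A by (intro compact_imp_seq_compact) (simp add: compact_operator_def)
      moreover have "\<forall>n. A (e n) \<in> closure (A ` cball 0 1)"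
      proof
        fix n
        have "e n \<in> cball 0 1"
          using e01[of n] by auto
        then show "A (e n) \<in> closure (A ` cball 0 1)"
          by (meson closure_subset imageI subsetD)
      qed
      ultimately obtain l r where r: "strict_mono (r :: nat \<Rightarrow> nat)" and "(\<lambda>n. A (e (r n))) \<longlonglongrightarrow> l"
        by (auto elim!: seq_compactE simp: comp_def)
      then have "Cauchy (\<lambda>n. A (e (r n)))"
        by (intro LIMSEQ_imp_Cauchy)
      then obtain M where M: "\<And>m n. m \<ge> M \<Longrightarrow> n \<ge> M \<Longrightarrow> norm (A (e (r m)) - A (e (r n))) < L"
        using \<open>0 < L\<close> unfolding Cauchy_iff by meson
      \<comment> \<open>the images \<open>A (e k)\<close> are orthogonal, so they stay apart if their norms do not tend to 0\<close>
      let ?i = "r M" and ?j = "r (Suc M)"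
      have "?i \<noteq> ?j"
        using strict_monoD[OF r, of M "Suc M"] by simp
      have "inner (A (e ?i)) (A (e ?j)) = 0" "inner (A (e ?j)) (A (e ?i)) = 0"
        using AeAe \<open>?i \<noteq> ?j\<close> by (simp_all add: inner_ell2_def)
      then have "(norm (A (e ?i) - A (e ?j)))\<^sup>2 = (s ?i)\<^sup>2 + (s ?j)\<^sup>2"
        by (simp add: power2_norm_eq_inner inner_diff_left inner_diff_right s_def)
      moreover have "L\<^sup>2 \<le> (s ?i)\<^sup>2"
        using L(2) \<open>0 < L\<close> by (intro power_mono) auto
      moreover have "(norm (A (e ?i) - A (e ?j)))\<^sup>2 < L\<^sup>2"
        using M[of M "Suc M"] by (intro power_strict_mono) auto
      moreover have "0 \<le> (s ?j)\<^sup>2" by simp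
      ultimately show False by linarith
    qed
    with L show ?thesis by simp
  qed
  have remainder: "norm (A x - (\<Sum>k<K. (of_real (s k) * cinner x (e k)) *\<^sub>C f k)) \<le> s K * norm x" for K x
  proof -
    define y where "y = x - (\<Sum>k<K. cinner x (e k) *\<^sub>C e k)"
    have "cinner y (e i) = 0" if "i < K" for i
    proof -
      have "cinner (\<Sum>k<K. cinner x (e k) *\<^sub>C e k) (e i) = cinner x (e i) * of_real ((norm (e i))\<^sup>2)"
        using that by (intro cinner_sum_orthogonal) (auto simp: orth)
      then show ?thesis
        using e01[of i] by (auto simp: y_def cinner.diff_left cinner.zero_right)
    qed
    then have "y \<in> V e K" by (simp add: V_def)
    moreover have "A y = A x - (\<Sum>k<K. (of_real (s k) * cinner x (e k)) *\<^sub>C f k)"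
      by (simp add: y_def A.diff A.sum compact_operator_scaleC[OF A] Aef mult.commute)
    ultimately have "norm (A x - (\<Sum>k<K. (of_real (s k) * cinner x (e k)) *\<^sub>C f k)) \<le> s K * norm y"
      using emax[of y K] by simp
    also have "norm y \<le> norm x"
    proof (rule power2_le_imp_le)
      have "0 \<le> (\<Sum>j<K. (cmod (cinner x (e j)))\<^sup>2 * (2 - (norm (e j))\<^sup>2))"
      proof (intro sum_nonneg mult_nonneg_nonneg)
        show "0 \<le> 2 - (norm (e j))\<^sup>2" for j
          using e01[of j] by auto
      qed simp
      then show "(norm y)\<^sup>2 \<le> (norm x)\<^sup>2"
        unfolding y_def norm_diff_projection[OF finite_lessThan suborthonormal_subset[OF sub_e subset_UNIV]]
        by simp
    qed simp
    finally show ?thesis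
      using s_nonneg[of K] by (simp add: mult_left_mono)
  qed
  \<comment> \<open>an eigenvector orthogonal to all \<open>e k\<close> is annihilated by \<open>A\<close>, as \<open>s k\<close> tends to 0\<close>
  have "card {k. s k = \<mu>} = ell2.dim (eigenspace (hilbert_adjoint A \<circ> A) (complex_of_real (\<mu>\<^sup>2)))"
    if \<mu>: "0 < \<mu>" for \<mu>
  proof -
    define K where "K = {k. s k = \<mu>}"
    define E where "E = eigenspace (hilbert_adjoint A \<circ> A) (complex_of_real (\<mu>\<^sup>2))"
    have E: "x \<in> E \<longleftrightarrow> T x = \<mu>\<^sup>2 *\<^sub>R x" for x
      by (simp add: E_def eigenspace_def T_def scaleR_ell2_def)
    have "finite K"
    proof -
      from order_tendstoD(2)[OF lim \<mu>] obtain N where "\<And>k. k \<ge> N \<Longrightarrow> s k < \<mu>"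
        unfolding eventually_sequentially by blast
      then have "K \<subseteq> {..<N}"
        unfolding K_def by (metis (mono_tags) lessThan_iff mem_Collect_eq not_less order_less_irrefl subsetI)
      then show ?thesis by (rule finite_subset) simp
    qed
    have on: "cinner (e i) (e j) = (if i = j then 1 else 0)" if "i \<in> K" "j \<in> K" for i j
      using that orth enorm[of i] \<mu> by (auto simp: K_def cinner_self)
    have "e ` K \<subseteq> E"
      using Te by (auto simp: E K_def)
    have "E \<subseteq> ell2.span (e ` K)"
    proof
      fix x assume x: "x \<in> E"
      define y where "y = x - (\<Sum>k\<in>K. cinner x (e k) *\<^sub>C e k)"
      have ortho: "cinner y (e i) = 0" for i
      proof (cases "i \<in> K")
        case True
        then have "cinner (\<Sum>k\<in>K. cinner x (e k) *\<^sub>C e k) (e i) = cinner x (e i) * of_real ((norm (e i))\<^sup>2)"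
          using \<open>finite K\<close> by (intro cinner_sum_orthogonal) (auto simp: orth)
        then show ?thesis
          using e01[of i] by (auto simp: y_def cinner.diff_left cinner.zero_right)
      next
        case False
        have "cinner (T x) (e i) = cinner x (T (e i))"
          by (rule T_sym)
        then have "of_real (\<mu>\<^sup>2) * cinner x (e i) = of_real ((s i)\<^sup>2) * cinner x (e i)"
          using x by (simp add: E Te cinner.scaleR_left cinner.scaleR_right scaleR_conv_of_real)
        moreover have "(s i)\<^sup>2 \<noteq> \<mu>\<^sup>2"
          using False \<mu> s_nonneg[of i] by (simp add: K_def power2_eq_iff_nonneg)
        ultimately have "cinner x (e i) = 0"
          by (metis mult_cancel_right of_real_eq_iff)
        moreover have "(\<Sum>k\<in>K. cinner x (e k) * cinner (e k) (e i)) = 0"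
          using False orth by (intro sum.neutral ballI) (metis mult_zero_right)
        ultimately show ?thesis
          by (simp add: y_def cinner.diff_left cinner.sum_left cinner_scaleC_left)
      qed
      have "norm (A y) \<le> s k * norm y" for k
        by (rule emax) (simp add: V_def ortho)
      moreover have "(\<lambda>k. s k * norm y) \<longlonglongrightarrow> 0 * norm y"
        by (intro tendsto_intros lim)
      ultimately have "norm (A y) \<le> 0 * norm y"
        by (intro LIMSEQ_le_const) auto
      then have "T y = 0"
        by (simp add: T_def As.zero)
      moreover have "T y = \<mu>\<^sup>2 *\<^sub>R y"
      proof -
        have Tc: "T (c *\<^sub>C x) = c *\<^sub>C T x" for c x
          by (rule ell2_cinner_eqI) (simp add: T_sym cinner_scaleC_left)
        have "T y = T x - (\<Sum>k\<in>K. cinner x (e k) *\<^sub>C T (e k))"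
          unfolding y_def Tc[symmetric] by (simp add: T_def A.diff As.diff A.sum As.sum)
        also have "\<dots> = \<mu>\<^sup>2 *\<^sub>R x - (\<Sum>k\<in>K. cinner x (e k) *\<^sub>C (\<mu>\<^sup>2 *\<^sub>R e k))"
          using x Te by (auto simp: E K_def intro!: arg_cong2[of _ _ _ _ minus] sum.cong)
        also have "\<dots> = \<mu>\<^sup>2 *\<^sub>R y"
          by (simp add: y_def scaleR_ell2_def ell2.scale_right_diff_distrib ell2.scale_sum_right
              mult.commute)
        finally show ?thesis .
      qed
      ultimately have "y = 0"
        using \<mu> by simp
      then have "x = (\<Sum>k\<in>K. cinner x (e k) *\<^sub>C e k)"
        by (simp add: y_def)
      also have "\<dots> \<in> ell2.span (e ` K)"
        by (intro ell2.span_sum ell2.span_scale ell2.span_base imageI)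
      finally show "x \<in> ell2.span (e ` K)" .
    qed
    then have "ell2.span (e ` K) = ell2.span E"
      using \<open>e ` K \<subseteq> E\<close> by (metis ell2.span_mono ell2.span_span subset_antisym)
    then have "ell2.dim E = card (e ` K)"
      using orthonormal_independent(2)[OF \<open>finite K\<close> on] by (intro ell2.dim_eq_card)
    also have "\<dots> = card K"
      using orthonormal_independent(1)[OF \<open>finite K\<close> on] by (rule card_image)
    finally show ?thesis
      by (simp add: K_def E_def)
  qed
  then have sv: "is_singular_value_sequence A s"
    using s_nonneg dec lim by (simp add: is_singular_value_sequence_def)
  have "singular_value A = s"
    unfolding singular_value_def
  proof (rule the_equality[where P = "is_singular_value_sequence A", OF sv])
    fix t assume "is_singular_value_sequence A t"
    with sv show "t = s"
      unfolding is_singular_value_sequence_def by (intro decseq_eqI_level_cards) auto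
  qed
  then show ?thesis
    using that[of e f] sv sub_e sub_f Aef Aeff remainder by simp
qed

section \<open>Convexity inequalities for powers\<close>

text \<open>This is Young's inequality for the product \<open>x \<cdot> 1\<close>.\<close>

lemma Bernoulli_powr:
  fixes x q :: real
  assumes "1 \<le> q" "0 \<le> x"
  shows "1 + q * (x - 1) \<le> x powr q"
proof (cases "q = 1")
  case False
  then have q: "1 < q" using assms by simp
  define r where "r = q / (q - 1)"
  have "1 < r" "1 / q + 1 / r = 1"
    using q by (simp_all add: r_def field_simps)
  from Youngs_inequality[OF q this assms(2), of 1] have "x \<le> x powr q / q + (1 - 1 / q)"
    using \<open>1 / q + 1 / r = 1\<close> by simp
  then have "q * x \<le> q * (x powr q / q + (1 - 1 / q))"
    using q by (intro mult_left_mono) auto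
  then show ?thesis
    using q by (simp add: distrib_left right_diff_distrib)
qed (use assms in simp)

lemma powr_Jensen:
  fixes w s :: "'a \<Rightarrow> real"
  assumes "finite I" "1 \<le> q" "\<And>i. i \<in> I \<Longrightarrow> 0 \<le> w i" "\<And>i. i \<in> I \<Longrightarrow> 0 \<le> s i" "sum w I \<le> 1"
  shows "(\<Sum>i\<in>I. w i * s i) powr q \<le> (\<Sum>i\<in>I. w i * s i powr q)"
proof -
  define m where "m = (\<Sum>i\<in>I. w i * s i)"
  have "0 \<le> m"
    unfolding m_def using assms by (intro sum_nonneg mult_nonneg_nonneg)
  show ?thesis
  proof (cases "m = 0")
    case True
    then show ?thesis
      using assms by (simp add: m_def[symmetric] sum_nonneg)
  next
    case False
    with \<open>0 \<le> m\<close> have m: "0 < m" by simp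
    \<comment> \<open>the graph of the power lies above its tangent at the weighted sum \<open>m\<close>\<close>
    have tangent: "m powr q * (1 + q * (s i / m - 1)) \<le> s i powr q" if "i \<in> I" for i
    proof -
      have "m powr q * (1 + q * (s i / m - 1)) \<le> m powr q * (s i / m) powr q"
        using assms m that by (intro mult_left_mono Bernoulli_powr) auto
      also have "\<dots> = s i powr q"
        using assms m that by (simp add: powr_divide)
      finally show ?thesis .
    qed
    have "(\<Sum>i\<in>I. w i * (1 + q * (s i / m - 1))) = (\<Sum>i\<in>I. w i * (1 - q) + (w i * s i) * (q / m))"
      by (intro sum.cong refl) (simp add: algebra_simps)
    also have "\<dots> = sum w I * (1 - q) + m * (q / m)"
      by (simp only: sum.distrib sum_distrib_right[symmetric] m_def[symmetric])
    finally have "1 \<le> (\<Sum>i\<in>I. w i * (1 + q * (s i / m - 1)))"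
      using mult_right_mono_neg[OF assms(5), of "1 - q"] assms(2) m by simp
    then have "m powr q * 1 \<le> m powr q * (\<Sum>i\<in>I. w i * (1 + q * (s i / m - 1)))"
      by (intro mult_left_mono) auto
    also have "\<dots> = (\<Sum>i\<in>I. w i * (m powr q * (1 + q * (s i / m - 1))))"
      by (simp only: sum_distrib_left mult_ac)
    also have "\<dots> \<le> (\<Sum>i\<in>I. w i * s i powr q)"
      using assms tangent by (intro sum_mono mult_left_mono) auto
    finally show ?thesis
      by (simp add: m_def)
  qed
qed

lemma Holder_inequality_finite:
  fixes a b :: "'a \<Rightarrow> real"
  assumes "1 < p" "1 < q" "1 / p + 1 / q = 1" "\<And>i. i \<in> I \<Longrightarrow> 0 \<le> a i" "\<And>i. i \<in> I \<Longrightarrow> 0 \<le> b i"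
    and "finite I"
  shows "(\<Sum>i\<in>I. a i * b i) \<le> (\<Sum>i\<in>I. a i powr p) powr (1 / p) * (\<Sum>i\<in>I. b i powr q) powr (1 / q)"
proof -
  define X where "X = (\<Sum>i\<in>I. a i powr p)"
  define Y where "Y = (\<Sum>i\<in>I. b i powr q)"
  have XY: "0 \<le> X" "0 \<le> Y"
    by (simp_all add: X_def Y_def sum_nonneg)
  show ?thesis
  proof (cases "X = 0 \<or> Y = 0")
    case True
    then have "\<forall>i\<in>I. a i = 0 \<or> b i = 0"
      unfolding X_def Y_def using assms(6) by (subst (asm) (1 2) sum_nonneg_eq_0_iff) auto
    then have "(\<Sum>i\<in>I. a i * b i) = 0"
      by (intro sum.neutral) auto
    then show ?thesis by simp
  next
    case False
    with XY have X: "0 < X" and Y: "0 < Y" by auto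
    define x where "x = X powr (1 / p)"
    define y where "y = Y powr (1 / q)"
    have xy: "0 < x" "0 < y" "x powr p = X" "y powr q = Y"
      using X Y assms(1,2) by (simp_all add: x_def y_def powr_powr)
    have "(\<Sum>i\<in>I. (a i / x) * (b i / y)) \<le> (\<Sum>i\<in>I. (a i / x) powr p / p + (b i / y) powr q / q)"
      using assms xy by (intro sum_mono Youngs_inequality) auto
    also have "\<dots> = (\<Sum>i\<in>I. a i powr p / (X * p) + b i powr q / (Y * q))"
      using assms xy by (intro sum.cong refl) (simp add: powr_divide)
    also have "\<dots> = X / (X * p) + Y / (Y * q)"
      by (simp add: sum.distrib sum_divide_distrib[symmetric] X_def Y_def)
    also have "\<dots> = 1"
      using X Y assms(3) by simp
    finally have "(\<Sum>i\<in>I. a i * b i) / (x * y) \<le> 1"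
      by (simp add: sum_divide_distrib)
    then show ?thesis
      using xy(1,2) by (simp add: x_def y_def X_def Y_def divide_le_eq)
  qed
qed

section \<open>Coefficients of Schatten class operators\<close>

lemma schatten_classD:
  assumes "A \<in> schatten_class q"
  shows "compact_operator A" "summable (\<lambda>k. singular_value A k powr q)"
  using assms by (simp_all add: schatten_class_def)

lemma singular_value_nonneg: "compact_operator A \<Longrightarrow> 0 \<le> singular_value A k"
  by (erule Schmidt_decomposition) (simp add: is_singular_value_sequence_def)

text \<open>
  Inserting the Schmidt expansion, \<open>\<bar>\<langle>A v\<^sub>j, u\<^sub>j\<rangle>\<bar> \<le> \<Sum>\<^sub>k w\<^sub>j\<^sub>k s\<^sub>k\<close> with
  \<open>w\<^sub>j\<^sub>k = \<bar>\<langle>v\<^sub>j, e\<^sub>k\<rangle>\<bar> \<bar>\<langle>f\<^sub>k, u\<^sub>j\<rangle>\<bar>\<close>. By Bessel's inequality all row and column sums of \<open>w\<close> are at most 1, so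
  convexity of the power gives the claim.
\<close>

theorem schatten_coefficient_inequality:
  assumes A: "A \<in> schatten_class q" and q: "1 \<le> q"
    and J: "finite J" "suborthonormal J u" "suborthonormal J v"
  shows "(\<Sum>j\<in>J. cmod (cinner (A (v j)) (u j)) powr q) \<le> (\<Sum>k. singular_value A k powr q)"
proof -
  define s where "s = singular_value A"
  obtain e f where sv: "is_singular_value_sequence A s"
    and sub: "suborthonormal UNIV e" "suborthonormal UNIV f"
    and rem: "\<And>K x. norm (A x - (\<Sum>k<K. (of_real (s k) * cinner x (e k)) *\<^sub>C f k)) \<le> s K * norm x"
    unfolding s_def by (rule Schmidt_decomposition[OF schatten_classD(1)[OF A]]) blast
  have s: "\<And>k. 0 \<le> s k" "s \<longlonglongrightarrow> 0"
    using sv by (simp_all add: is_singular_value_sequence_def)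
  define a where "a K j = (\<Sum>k<K. of_real (s k) * cinner (v j) (e k) * cinner (f k) (u j))" for K j
  have lim: "(\<lambda>K. a K j) \<longlonglongrightarrow> cinner (A (v j)) (u j)" for j
  proof -
    have "(\<lambda>K. A (v j) - (\<Sum>k<K. (of_real (s k) * cinner (v j) (e k)) *\<^sub>C f k)) \<longlonglongrightarrow> 0"
    proof (rule Lim_null_comparison)
      show "(\<lambda>K. s K * norm (v j)) \<longlonglongrightarrow> 0"
        using tendsto_mult_right[OF s(2)] by simp
    qed (simp add: rem)
    from tendsto_diff[OF tendsto_const[of "A (v j)"] this]
    have "(\<lambda>K. \<Sum>k<K. (of_real (s k) * cinner (v j) (e k)) *\<^sub>C f k) \<longlonglongrightarrow> A (v j)"
      by simp
    from cinner.tendsto[OF this tendsto_const[of "u j"]] show ?thesis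
      by (simp add: a_def cinner.sum_left cinner_scaleC_left)
  qed
  have bound: "(\<Sum>j\<in>J. cmod (a K j) powr q) \<le> (\<Sum>k. s k powr q)" for K
  proof -
    define w where "w j k = cmod (cinner (v j) (e k)) * cmod (cinner (u j) (f k))" for j k
    have w: "0 \<le> w j k" for j k
      by (simp add: w_def)
    have unit: "norm (v j) * norm (u j) \<le> 1" if "j \<in> J" for j
      using J that by (intro mult_le_one) (auto simp: suborthonormal_def)
    have row: "(\<Sum>k<K. w j k) \<le> 1" if "j \<in> J" for j
    proof -
      have "(\<Sum>k<K. w j k) \<le> norm (v j) * norm (u j)"
        unfolding w_def
        by (rule Bessel_inequality_product[OF finite_lessThan sub[THEN suborthonormal_subset[OF _ subset_UNIV]]])
      then show ?thesis
        using unit[OF that] by simp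
    qed
    have col: "(\<Sum>j\<in>J. w j k) \<le> 1" for k
    proof -
      have "(\<Sum>j\<in>J. w j k) = (\<Sum>j\<in>J. cmod (cinner (e k) (v j)) * cmod (cinner (f k) (u j)))"
        unfolding w_def by (intro sum.cong refl) (metis cnj_cinner complex_mod_cnj)
      also have "\<dots> \<le> norm (e k) * norm (f k)"
        by (intro Bessel_inequality_product J)
      also have "\<dots> \<le> 1"
        using sub by (intro mult_le_one) (auto simp: suborthonormal_def)
      finally show ?thesis .
    qed
    have "cmod (a K j) powr q \<le> (\<Sum>k<K. w j k * s k powr q)" if "j \<in> J" for j
    proof -
      have "cmod (a K j) \<le> (\<Sum>k<K. cmod (of_real (s k) * cinner (v j) (e k) * cinner (f k) (u j)))"
        unfolding a_def by (rule norm_sum)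
      also have "\<dots> = (\<Sum>k<K. w j k * s k)"
      proof (intro sum.cong refl)
        fix k
        have "cmod (cinner (f k) (u j)) = cmod (cinner (u j) (f k))"
          by (metis cnj_cinner complex_mod_cnj)
        then show "cmod (of_real (s k) * cinner (v j) (e k) * cinner (f k) (u j)) = w j k * s k"
          using s(1)[of k] by (simp add: norm_mult w_def)
      qed
      finally have "cmod (a K j) powr q \<le> (\<Sum>k<K. w j k * s k) powr q"
        using q by (intro powr_mono2) auto
      also have "\<dots> \<le> (\<Sum>k<K. w j k * s k powr q)"
        using q w s row[OF that] by (intro powr_Jensen) auto
      finally show ?thesis .
    qed
    then have "(\<Sum>j\<in>J. cmod (a K j) powr q) \<le> (\<Sum>j\<in>J. \<Sum>k<K. w j k * s k powr q)"
      by (rule sum_mono)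
    also have "\<dots> = (\<Sum>k<K. (\<Sum>j\<in>J. w j k) * s k powr q)"
      by (subst sum.swap) (simp add: sum_distrib_right)
    also have "\<dots> \<le> (\<Sum>k<K. 1 * s k powr q)"
      by (intro sum_mono mult_right_mono col) simp
    also have "\<dots> \<le> (\<Sum>k. s k powr q)"
      unfolding mult_1 using schatten_classD(2)[OF A] by (intro sum_le_suminf) (simp_all add: s_def)
    finally show ?thesis .
  qed
  have "(\<lambda>K. \<Sum>j\<in>J. cmod (a K j) powr q) \<longlonglongrightarrow> (\<Sum>j\<in>J. cmod (cinner (A (v j)) (u j)) powr q)"
    using q by (intro tendsto_sum tendsto_powr' tendsto_norm lim tendsto_const) auto
  then show ?thesis
    unfolding s_def[symmetric] by (rule LIMSEQ_le_const2) (use bound in auto)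
qed

text \<open>By Hoelder's inequality: this is the pairing with an operator \<open>\<Sum>\<^sub>j b\<^sub>j u\<^sub>j \<otimes> v\<^sub>j\<close>, whose norm in the dual class is at most \<open>\<parallel>b\<parallel>\<^sub>r\<close>.\<close>

corollary schatten_pairing_inequality:
  assumes A: "A \<in> schatten_class q" and q: "1 < q" "1 < r" "1 / q + 1 / r = 1"
    and J: "finite J" "suborthonormal J u" "suborthonormal J v"
  shows "cmod (\<Sum>j\<in>J. of_real (b j) * cinner (A (v j)) (u j))
    \<le> (\<Sum>j\<in>J. \<bar>b j\<bar> powr r) powr (1 / r) * schatten_norm q A"
proof -
  have "cmod (\<Sum>j\<in>J. of_real (b j) * cinner (A (v j)) (u j))
      \<le> (\<Sum>j\<in>J. \<bar>b j\<bar> * cmod (cinner (A (v j)) (u j)))"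
    by (rule order_trans[OF norm_sum]) (simp add: norm_mult)
  also have "\<dots> \<le> (\<Sum>j\<in>J. \<bar>b j\<bar> powr r) powr (1 / r)
      * (\<Sum>j\<in>J. cmod (cinner (A (v j)) (u j)) powr q) powr (1 / q)"
    using q J by (intro Holder_inequality_finite) auto
  also have "\<dots> \<le> (\<Sum>j\<in>J. \<bar>b j\<bar> powr r) powr (1 / r) * schatten_norm q A"
    unfolding schatten_norm_def
    using q by (intro mult_left_mono powr_mono2 schatten_coefficient_inequality[OF A _ J] sum_nonneg) auto
  finally show ?thesis .
qed

text \<open>
  Membership in the Schatten class is tested against the operator's own Schmidt vectors, because the
  singular values are the coefficients \<open>\<langle>A e\<^sub>k, f\<^sub>k\<rangle>\<close>.
\<close>

lemma schatten_classI:
  assumes A: "compact_operator A"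
    and bound: "\<And>(e :: nat \<Rightarrow> ell2) f K. suborthonormal {..<K} e \<Longrightarrow> suborthonormal {..<K} f \<Longrightarrow>
      (\<Sum>k<K. cmod (cinner (A (e k)) (f k)) powr q) \<le> C"
  shows "A \<in> schatten_class q"
proof -
  obtain e f where sub: "suborthonormal UNIV e" "suborthonormal UNIV f"
    and coeff: "\<And>k. cinner (A (e k)) (f k) = of_real (singular_value A k)"
    by (rule Schmidt_decomposition[OF A]) blast
  have "(\<Sum>k<K. singular_value A k powr q) \<le> C" for K
    using bound[of K e f] sub[THEN suborthonormal_subset[OF _ subset_UNIV]]
      singular_value_nonneg[OF A] by (simp add: coeff)
  then have "summable (\<lambda>k. singular_value A k powr q)"
    by (intro summableI_nonneg_bounded) auto
  then show ?thesis
    using A by (simp add: schatten_class_def)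
qed

lemma schatten_class_add:
  assumes A: "A \<in> schatten_class q" and B: "B \<in> schatten_class q" and q: "1 \<le> q"
  shows "(\<lambda>x. A x + B x) \<in> schatten_class q"
proof (rule schatten_classI)
  show "compact_operator (\<lambda>x. A x + B x)"
    by (intro compact_operator_add schatten_classD(1)[OF A] schatten_classD(1)[OF B])
  fix e f :: "nat \<Rightarrow> ell2" and K assume sub: "suborthonormal {..<K} e" "suborthonormal {..<K} f"
  have convex: "cmod (x + y) powr q \<le> 2 powr q * (cmod x powr q + cmod y powr q)" for x y
  proof -
    have "cmod (x + y) powr q \<le> (2 * max (cmod x) (cmod y)) powr q"
      using q norm_triangle_ineq[of x y] by (intro powr_mono2) auto
    also have "\<dots> = 2 powr q * max (cmod x) (cmod y) powr q"
      by (intro powr_mult)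
    also have "\<dots> \<le> 2 powr q * (cmod x powr q + cmod y powr q)"
      by (intro mult_left_mono) (auto simp: max_def)
    finally show ?thesis .
  qed
  have "(\<Sum>k<K. cmod (cinner (A (e k) + B (e k)) (f k)) powr q)
      \<le> (\<Sum>k<K. 2 powr q * (cmod (cinner (A (e k)) (f k)) powr q + cmod (cinner (B (e k)) (f k)) powr q))"
    unfolding cinner_add_left by (intro sum_mono convex)
  also have "\<dots> = 2 powr q * ((\<Sum>k<K. cmod (cinner (A (e k)) (f k)) powr q)
      + (\<Sum>k<K. cmod (cinner (B (e k)) (f k)) powr q))"
    by (simp add: sum_distrib_left[symmetric] sum.distrib)
  also have "\<dots> \<le> 2 powr q * ((\<Sum>k. singular_value A k powr q) + (\<Sum>k. singular_value B k powr q))"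
    using sub A B q by (intro mult_left_mono add_mono schatten_coefficient_inequality) auto
  finally show "(\<Sum>k<K. cmod (cinner (A (e k) + B (e k)) (f k)) powr q)
      \<le> 2 powr q * ((\<Sum>k. singular_value A k powr q) + (\<Sum>k. singular_value B k powr q))" .
qed

lemma schatten_class_scaleC:
  assumes A: "A \<in> schatten_class q" and q: "1 \<le> q"
  shows "(\<lambda>x. c *\<^sub>C A x) \<in> schatten_class q"
proof (rule schatten_classI)
  show "compact_operator (\<lambda>x. c *\<^sub>C A x)"
    by (intro compact_operator_scale schatten_classD(1)[OF A])
  fix e f :: "nat \<Rightarrow> ell2" and K assume sub: "suborthonormal {..<K} e" "suborthonormal {..<K} f"
  have "(\<Sum>k<K. cmod (cinner (c *\<^sub>C A (e k)) (f k)) powr q)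
      = cmod c powr q * (\<Sum>k<K. cmod (cinner (A (e k)) (f k)) powr q)"
    by (simp add: cinner_scaleC_left norm_mult powr_mult sum_distrib_left)
  also have "\<dots> \<le> cmod c powr q * (\<Sum>k. singular_value A k powr q)"
    using sub A q by (intro mult_left_mono schatten_coefficient_inequality) auto
  finally show "(\<Sum>k<K. cmod (cinner (c *\<^sub>C A (e k)) (f k)) powr q)
      \<le> cmod c powr q * (\<Sum>k. singular_value A k powr q)" .
qed

text \<open>
  By Bessel's inequality the coefficients are even summable, and each is at most \<open>\<parallel>a\<parallel> \<parallel>b\<parallel>\<close>, which
  raises the exponent from 1 to \<open>q\<close>.
\<close>

lemma rank_one_in_schatten_class:
  assumes q: "1 \<le> q"
  shows "(\<lambda>x. cinner x a *\<^sub>C b) \<in> schatten_class q"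
proof (rule schatten_classI)
  show "compact_operator (\<lambda>x. cinner x a *\<^sub>C b)"
  proof (rule compact_operatorI)
    have "bounded_linear (\<lambda>c. c *\<^sub>C b)"
      by (rule bounded_linear_intro[where K = "norm b"])
        (simp_all add: ell2.scale_left_distrib scaleR_ell2_def norm_scaleC scaleR_conv_of_real)
    then show "compact ((\<lambda>c. c *\<^sub>C b) ` cball 0 (norm a))"
      by (intro compact_continuous_image linear_continuous_on compact_cball)
    fix x :: ell2 assume "norm x \<le> 1"
    then have "cmod (cinner x a) \<le> norm a"
      using cmod_cinner_le[of x a] mult_right_mono[of "norm x" 1 "norm a"] by simp
    then show "cinner x a *\<^sub>C b \<in> (\<lambda>c. c *\<^sub>C b) ` cball 0 (norm a)"
      by (intro imageI) simp
  qed (simp_all add: cinner_add_left cinner_scaleC_left ell2.scale_left_distrib)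
  define C where "C = norm a * norm b"
  fix e f :: "nat \<Rightarrow> ell2" and K assume sub: "suborthonormal {..<K} e" "suborthonormal {..<K} f"
  define t where "t k = cmod (cinner a (e k)) * cmod (cinner b (f k))" for k
  have ea: "cmod (cinner (e k) a) = cmod (cinner a (e k))" for k
    by (metis cnj_cinner complex_mod_cnj)
  have sum_t: "(\<Sum>k<K. t k) \<le> C"
    unfolding t_def C_def by (intro Bessel_inequality_product sub) simp
  have "t k powr q \<le> C powr (q - 1) * t k" if "k < K" for k
  proof (cases "t k = 0")
    case False
    have "t k \<le> (\<Sum>k<K. t k)"
      using that by (intro member_le_sum) (auto simp: t_def)
    with sum_t have "t k \<le> C" by simp
    have "t k powr q = t k powr (q - 1) * t k"
      using False powr_add[of "t k" "q - 1" 1] by (simp add: t_def)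
    also have "\<dots> \<le> C powr (q - 1) * t k"
      using q \<open>t k \<le> C\<close> by (intro mult_right_mono powr_mono2) (auto simp: t_def)
    finally show ?thesis .
  qed simp
  then have "(\<Sum>k<K. t k powr q) \<le> C powr (q - 1) * (\<Sum>k<K. t k)"
    unfolding sum_distrib_left by (intro sum_mono) simp
  also have "\<dots> \<le> C powr (q - 1) * C"
    by (intro mult_left_mono sum_t) simp
  finally show "(\<Sum>k<K. cmod (cinner (cinner (e k) a *\<^sub>C b) (f k)) powr q) \<le> C powr (q - 1) * C"
    by (simp add: cinner_scaleC_left norm_mult ea t_def)
qed

lemma finite_rank_in_schatten_class:
  assumes "finite I" "1 \<le> q"
  shows "(\<lambda>x. \<Sum>i\<in>I. cinner x (a i) *\<^sub>C b i) \<in> schatten_class q"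
  using assms(1)
proof (induction I rule: finite_induct)
  case empty
  show ?case
    using rank_one_in_schatten_class[OF assms(2), of 0 0] by simp
next
  case (insert i I)
  then show ?case
    using schatten_class_add[OF rank_one_in_schatten_class[OF assms(2), of "a i" "b i"] _ assms(2)] by simp
qed

section \<open>Divisors of products of powers of distinct primes\<close>

lemma card_divisors_mult_coprime:
  fixes a b :: nat
  assumes "coprime a b"
  shows "card {m. m dvd a * b} = card {m. m dvd a} * card {m. m dvd b}"
proof -
  have "bij_betw (\<lambda>(x, y). x * y) ({m. m dvd a} \<times> {m. m dvd b}) {m. m dvd a * b}"
    unfolding bij_betw_def
  proof (intro conjI)
    have *: "gcd (x * y) a = x" "gcd (x * y) b = y" if "x dvd a" "y dvd b" for x y
    proof -
      have "coprime y a" "coprime x b"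
        using that assms by (meson coprime_commute coprime_divisors dvd_refl)+
      then show "gcd (x * y) a = x"
        using that by (simp add: gcd_mult_left_right_cancel gcd_proj1_if_dvd coprime_commute)
      show "gcd (x * y) b = y"
        using that \<open>coprime x b\<close> by (simp add: gcd_mult_left_left_cancel gcd_proj1_if_dvd coprime_commute)
    qed
    show "inj_on (\<lambda>(x, y). x * y) ({m. m dvd a} \<times> {m. m dvd b})"
      by (rule inj_onI) (auto, (metis *)+)
    show "(\<lambda>(x, y). x * y) ` ({m. m dvd a} \<times> {m. m dvd b}) = {m. m dvd a * b}"
      by (force intro: mult_dvd_mono dest: division_decomp)
  qed
  then show ?thesis
    by (simp add: bij_betw_same_card[symmetric] card_cartesian_product)
qed

lemma card_divisors_prime_power:
  fixes p :: nat
  assumes "prime p"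
  shows "card {m. m dvd p ^ n} = n + 1"
proof -
  have "{m. m dvd p ^ n} = (\<lambda>i. p ^ i) ` {..n}"
    using divides_primepow_nat[OF assms] by auto
  moreover have "inj_on (\<lambda>i. p ^ i) {..n}"
    using prime_gt_1_nat[OF assms] by (intro inj_onI) simp
  ultimately show ?thesis
    by (simp add: card_image)
qed

text \<open>Only odd primes are used, so that the exponent of 2 is free to serve as a label.\<close>

definition odd_prime :: "nat \<Rightarrow> nat"
  where "odd_prime = enumerate {p. prime p \<and> odd p}"

lemma infinite_odd_primes: "infinite {p :: nat. prime p \<and> odd p}"
proof
  assume "finite {p :: nat. prime p \<and> odd p}"
  then have "finite (insert 2 {p :: nat. prime p \<and> odd p})" by simp
  moreover have "{p :: nat. prime p} \<subseteq> insert 2 {p. prime p \<and> odd p}"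
    using primes_dvd_imp_eq two_is_prime_nat by blast
  ultimately show False
    using primes_infinite finite_subset by blast
qed

lemma odd_prime: "prime (odd_prime i)" "odd (odd_prime i)"
  using enumerate_in_set[OF infinite_odd_primes, of i] by (simp_all add: odd_prime_def)

lemma odd_prime_eq_iff: "odd_prime i = odd_prime j \<longleftrightarrow> i = j"
  using strict_mono_enumerate[OF infinite_odd_primes] by (auto simp: odd_prime_def strict_mono_eq)

definition prime_product :: "nat \<Rightarrow> (nat \<Rightarrow> nat) \<Rightarrow> nat"
  where "prime_product d a = (\<Prod>i<d. odd_prime i ^ a i)"

lemma prime_product_pos: "0 < prime_product d a"
  unfolding prime_product_def using odd_prime(1) by (intro prod_pos) (simp add: prime_gt_0_nat)

lemma prime_product_add: "prime_product d (\<lambda>i. a i + b i) = prime_product d a * prime_product d b"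
  by (simp add: prime_product_def power_add prod.distrib)

lemma odd_prime_product: "odd (prime_product d a)"
  unfolding prime_product_def using odd_prime(2) by (induction d) simp_all

lemma coprime_prime_product:
  assumes "d \<le> j"
  shows "coprime (prime_product d a) (odd_prime j ^ n)"
  unfolding prime_product_def
proof (rule prod_coprime_left)
  fix i assume "i \<in> {..<d}"
  then have "coprime (odd_prime i) (odd_prime j)"
    using assms by (intro primes_coprime odd_prime) (simp add: odd_prime_eq_iff)
  then show "coprime (odd_prime i ^ a i) (odd_prime j ^ n)"
    by simp
qed

lemma card_divisors_prime_product: "card {m. m dvd prime_product d a} = (\<Prod>i<d. a i + 1)"
proof (induction d)
  case 0
  have "{m :: nat. m dvd 1} = {1}" by auto
  then show ?case by (simp add: prime_product_def)
next
  case (Suc d)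
  have "prime_product (Suc d) a = prime_product d a * odd_prime d ^ a d"
    by (simp add: prime_product_def mult.commute)
  then show ?case
    using card_divisors_mult_coprime[OF coprime_prime_product[of d d a "a d"]] Suc
    by (simp add: card_divisors_prime_power[OF odd_prime(1)] mult.commute)
qed

lemma prime_product_eq_iff: "prime_product d a = prime_product d b \<longleftrightarrow> (\<forall>i<d. a i = b i)"
proof
  assume eq: "prime_product d a = prime_product d b"
  have "multiplicity (odd_prime i) (prime_product d a) = a i" if "i < d" for i a
  proof -
    have "multiplicity (odd_prime i) (prime_product d a)
        = (\<Sum>j<d. multiplicity (odd_prime i) (odd_prime j ^ a j))"
      unfolding prime_product_def
    proof (rule prime_elem_multiplicity_prod_distrib)
      show "0 \<notin> (\<lambda>j. odd_prime j ^ a j) ` {..<d}"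
        using odd_prime(1) by (auto simp: prime_gt_0_nat) (metis not_prime_0)
    qed (use odd_prime(1) in \<open>auto intro: prime_imp_prime_elem\<close>)
    also have "\<dots> = (\<Sum>j<d. if j = i then a i else 0)"
      using odd_prime(1) by (intro sum.cong refl)
        (auto simp: odd_prime_eq_iff intro: multiplicity_distinct_prime_power
          multiplicity_prime_power)
    finally show ?thesis
      using that by simp
  qed
  then show "\<forall>i<d. a i = b i"
    using eq by metis
next
  assume "\<forall>i<d. a i = b i"
  then show "prime_product d a = prime_product d b"
    unfolding prime_product_def by (intro prod.cong) auto
qed

text \<open>The factor \<open>2 ^ d\<close> makes the numbers belonging to different \<open>d\<close> distinct.\<close>

definition block_index :: "nat \<Rightarrow> (nat \<Rightarrow> nat) \<Rightarrow> nat"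
  where "block_index d a = 2 ^ d * prime_product d a"

lemma block_index_pos: "0 < block_index d a"
  by (simp add: block_index_def prime_product_pos)

lemma multiplicity_two_block_index: "multiplicity 2 (block_index d a) = d"
proof -
  have "multiplicity 2 (block_index d a) = multiplicity 2 ((2 :: nat) ^ d) + multiplicity 2 (prime_product d a)"
    unfolding block_index_def using prime_product_pos[of d a]
    by (intro prime_elem_multiplicity_mult_distrib) auto
  also have "multiplicity 2 (prime_product d a) = 0"
    by (intro not_dvd_imp_multiplicity_0 odd_prime_product)
  finally show ?thesis by simp
qed

lemma block_index_eq_iff:
  "block_index d a = block_index d' b \<longleftrightarrow> d = d' \<and> (\<forall>i<d. a i = b i)"
proof
  assume eq: "block_index d a = block_index d' b"
  then have "d = d'"
    by (metis multiplicity_two_block_index)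
  with eq show "d = d' \<and> (\<forall>i<d. a i = b i)"
    by (simp add: block_index_def prime_product_eq_iff)
next
  assume "d = d' \<and> (\<forall>i<d. a i = b i)"
  then show "block_index d a = block_index d' b"
    by (simp add: block_index_def prime_product_eq_iff)
qed

lemma card_divisors_block_index:
  "card {m. m dvd block_index d a} = (d + 1) * (\<Prod>i<d. a i + 1)"
proof -
  have "coprime (2 ^ d) (prime_product d a)"
    using odd_prime_product[of d a] by simp
  then show ?thesis
    unfolding block_index_def using card_divisors_mult_coprime[of "2 ^ d" "prime_product d a"]
    by (simp add: card_divisors_prime_power[OF two_is_prime_nat] card_divisors_prime_product)
qed

section \<open>Sums over the vertices of a cube\<close>

definition bits :: "nat \<Rightarrow> (nat \<Rightarrow> nat) set"
  where "bits d = (\<Pi>\<^sub>E i\<in>{..<d}. {0, 1})"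

lemma finite_bits: "finite (bits d)"
  by (simp add: bits_def finite_PiE)

lemma bits_eqI: "R \<in> bits d \<Longrightarrow> S \<in> bits d \<Longrightarrow> (\<And>i. i < d \<Longrightarrow> R i = S i) \<Longrightarrow> R = S"
  unfolding bits_def by (rule PiE_ext) auto

lemma sum_bits:
  fixes G :: "nat \<Rightarrow> nat \<Rightarrow> 'b :: comm_semiring_1"
  shows "(\<Sum>S\<in>bits d. \<Prod>i<d. G i (S i)) = (\<Prod>i<d. G i 0 + G i 1)"
proof -
  have "(\<Prod>i<d. \<Sum>a\<in>{0, 1}. G i a) = (\<Sum>S\<in>bits d. \<Prod>i<d. G i (S i))"
    unfolding bits_def by (rule prod_sum_PiE) auto
  then show ?thesis by simp
qed

lemma sum_bits_4:
  fixes F :: "nat \<Rightarrow> nat \<Rightarrow> nat \<Rightarrow> nat \<Rightarrow> 'b :: comm_semiring_1"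
  shows "(\<Sum>S\<in>bits d. \<Sum>S'\<in>bits d. \<Sum>R\<in>bits d. \<Sum>R'\<in>bits d. \<Prod>i<d. F (S i) (S' i) (R i) (R' i))
    = (\<Sum>x\<in>{0, 1}. \<Sum>x'\<in>{0, 1}. \<Sum>y\<in>{0, 1}. \<Sum>y'\<in>{0, 1}. F x x' y y') ^ d"
proof -
  have 1: "(\<Sum>R'\<in>bits d. \<Prod>i<d. F (S i) (S' i) (R i) (R' i))
      = (\<Prod>i<d. \<Sum>y'\<in>{0, 1}. F (S i) (S' i) (R i) y')" for S S' R
    using sum_bits[of "\<lambda>i. F (S i) (S' i) (R i)" d] by simp
  have 2: "(\<Sum>R\<in>bits d. \<Prod>i<d. \<Sum>y'\<in>{0, 1}. F (S i) (S' i) (R i) y')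
      = (\<Prod>i<d. \<Sum>y\<in>{0, 1}. \<Sum>y'\<in>{0, 1}. F (S i) (S' i) y y')" for S S'
    using sum_bits[of "\<lambda>i y. \<Sum>y'\<in>{0, 1}. F (S i) (S' i) y y'" d] by simp
  have 3: "(\<Sum>S'\<in>bits d. \<Prod>i<d. \<Sum>y\<in>{0, 1}. \<Sum>y'\<in>{0, 1}. F (S i) (S' i) y y')
      = (\<Prod>i<d. \<Sum>x'\<in>{0, 1}. \<Sum>y\<in>{0, 1}. \<Sum>y'\<in>{0, 1}. F (S i) x' y y')" for S
    using sum_bits[of "\<lambda>i x'. \<Sum>y\<in>{0, 1}. \<Sum>y'\<in>{0, 1}. F (S i) x' y y'" d] by simp
  have 4: "(\<Sum>S\<in>bits d. \<Prod>i<d. \<Sum>x'\<in>{0, 1}. \<Sum>y\<in>{0, 1}. \<Sum>y'\<in>{0, 1}. F (S i) x' y y')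
      = (\<Prod>i<d. \<Sum>x\<in>{0, 1}. \<Sum>x'\<in>{0, 1}. \<Sum>y\<in>{0, 1}. \<Sum>y'\<in>{0, 1}. F x x' y y')"
    using sum_bits[of "\<lambda>i x. \<Sum>x'\<in>{0, 1}. \<Sum>y\<in>{0, 1}. \<Sum>y'\<in>{0, 1}. F x x' y y'" d] by simp
  show ?thesis
    unfolding 1 2 3 4 by simp
qed

section \<open>Helson matrices with a single nonzero coefficient\<close>

definition divisor_operator :: "nat \<Rightarrow> ell2 \<Rightarrow> ell2"
  where "divisor_operator k x = (\<Sum>m | m dvd k. cinner x (basis (k div m)) *\<^sub>C basis m)"

lemma cinner_divisor_operator:
  assumes "0 < k"
  shows "cinner (divisor_operator k x) (basis m) = (if m dvd k then coord x (k div m) else 0)"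
proof -
  have "finite {m. m dvd k}"
    using assms by simp
  have "cinner (divisor_operator k x) (basis m)
      = (\<Sum>j | j dvd k. coord x (k div j) * coord (basis j) m)"
    unfolding divisor_operator_def cinner.sum_left cinner_scaleC_left
    by (simp add: cinner_basis_right)
  also have "\<dots> = (\<Sum>j | j dvd k. if j = m then coord x (k div m) else 0)"
    using assms dvd_pos_nat[of k] by (intro sum.cong refl) (auto simp: coord_basis Suc_le_eq)
  finally show ?thesis
    using \<open>finite {m. m dvd k}\<close> by simp
qed

lemma divisor_operator_represents:
  assumes "0 < k"
  shows "represents (helson_matrix (\<lambda>j. if j = k then 1 else 0)) (divisor_operator k)"
  unfolding represents_def helson_matrix_def
proof (intro allI impI)
  fix m n :: nat assume mn: "1 \<le> m" "1 \<le> n"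
  have "m dvd k \<and> k div m = n \<longleftrightarrow> m * n = k"
    using mn by auto
  then show "cinner (divisor_operator k (basis n)) (basis m) = (if m * n = k then 1 else 0)"
    unfolding cinner_divisor_operator[OF assms] using mn by (auto simp: coord_basis)
qed

lemma divisor_operator_in_schatten_helson:
  assumes "0 < k" "1 \<le> q"
  shows "divisor_operator k \<in> schatten_helson q"
proof -
  have "divisor_operator k \<in> schatten_class q"
    unfolding divisor_operator_def[abs_def] using assms by (intro finite_rank_in_schatten_class) simp_all
  then show ?thesis
    using divisor_operator_represents[OF assms(1)] by (auto simp: schatten_helson_def)
qed

text \<open>The trace collects one copy of the conjugate of \<open>\<rho> k\<close> for each of the factorisations \<open>k = m n\<close>.\<close>

lemma pairing_divisor_operator:
  assumes M: "compact_operator M" "represents (helson_matrix \<rho>) M" and k: "0 < k"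
  shows "pairing (divisor_operator k) M = of_nat (card {m. m dvd k}) * cnj (\<rho> k)"
proof -
  define h where "h m = cinner (divisor_operator k (hilbert_adjoint M (basis m))) (basis m)" for m
  have h: "h m = (if m dvd k then cnj (\<rho> k) else 0)" for m
  proof (cases "m dvd k")
    case True
    then have "1 \<le> m" "1 \<le> k div m" "m * (k div m) = k"
      using k by (auto simp: Suc_le_eq dvd_pos_nat div_greater_zero_iff dvd_imp_le)
    have "h m = coord (hilbert_adjoint M (basis m)) (k div m)"
      by (simp add: h_def cinner_divisor_operator[OF k] True)
    also have "\<dots> = cnj (cinner (M (basis (k div m))) (basis m))"
      unfolding cinner_hilbert_adjoint[OF M(1)] cnj_cinner by (simp add: cinner_basis_right)
    also have "\<dots> = cnj (\<rho> k)"
      using M(2) \<open>1 \<le> m\<close> \<open>1 \<le> k div m\<close> \<open>m * (k div m) = k\<close>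
      unfolding represents_def helson_matrix_def by metis
    finally show ?thesis using True by simp
  qed (simp add: h_def cinner_divisor_operator[OF k])
  have "(\<lambda>n. h (Suc n)) sums (\<Sum>n | Suc n dvd k. h (Suc n))"
  proof (rule sums_finite)
    show "finite {n. Suc n dvd k}"
      using k by (rule_tac finite_subset[of _ "{..k}"]) (auto dest: dvd_imp_le)
  qed (simp add: h)
  then have "pairing (divisor_operator k) M = (\<Sum>n | Suc n dvd k. h (Suc n))"
    by (simp add: pairing_def op_trace_def comp_def h_def sums_iff)
  also have "\<dots> = of_nat (card {n. Suc n dvd k}) * cnj (\<rho> k)"
    by (simp add: h)
  also have "card {n. Suc n dvd k} = card {m. m dvd k}"
  proof (rule bij_betw_same_card)
    show "bij_betw Suc {n. Suc n dvd k} {m. m dvd k}"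
      unfolding bij_betw_def
    proof (intro conjI set_eqI iffI)
      fix m assume "m \<in> {m. m dvd k}"
      then show "m \<in> Suc ` {n. Suc n dvd k}"
        using k by (cases m) auto
    qed auto
  qed
  finally show ?thesis .
qed

section \<open>Tensor powers of a rotated pair of vectors\<close>

lemma cinner_sum_basis:
  assumes "finite I" "inj_on n I" "\<And>i. i \<in> I \<Longrightarrow> 0 < n i"
  shows "cinner (\<Sum>i\<in>I. a i *\<^sub>C basis (n i)) (\<Sum>i\<in>I. b i *\<^sub>C basis (n i)) = (\<Sum>i\<in>I. a i * cnj (b i))"
proof -
  have "cinner (\<Sum>i\<in>I. a i *\<^sub>C basis (n i)) (\<Sum>i\<in>I. b i *\<^sub>C basis (n i))
      = (\<Sum>i\<in>I. \<Sum>j\<in>I. a j * cnj (b i) * coord (basis (n j)) (n i))"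
    unfolding cinner.sum_right unfolding cinner.sum_left cinner_scaleC_left cinner_scaleC_right
    by (simp add: cinner_basis_right sum_distrib_left mult_ac)
  also have "\<dots> = (\<Sum>i\<in>I. \<Sum>j\<in>I. if j = i then a i * cnj (b i) else 0)"
    using assms by (intro sum.cong refl) (auto simp: coord_basis Suc_le_eq dest: inj_onD)
  finally show ?thesis
    using assms(1) by simp
qed

lemma prod_if_all:
  fixes f :: "nat \<Rightarrow> 'a :: comm_semiring_1"
  shows "(\<Prod>i<d. if P i then f i else 0) = (if \<forall>i<d. P i then \<Prod>i<d. f i else 0)"
  by (induction d) (auto simp: less_Suc_eq)

text \<open>
  The vectors \<open>v\<^sub>0 = (c, s)\<close> and \<open>v\<^sub>1 = (-s, c)\<close> form an orthonormal basis of the plane spanned by the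
  basis vectors at \<open>1\<close> and at one prime. The vectors \<open>right_vec d \<sigma>\<close> are the tensor products of the
  \<open>v\<^bsub>\<sigma> i\<^esub>\<close> over \<open>d\<close> different primes.
\<close>

locale rotation =
  fixes c s :: real
  assumes unit: "c\<^sup>2 + s\<^sup>2 = 1"
begin

definition entry :: "nat \<Rightarrow> nat \<Rightarrow> real"
  where "entry j x = (if j = 0 then if x = 0 then c else s else if x = 0 then - s else c)"

definition coeff :: "nat \<Rightarrow> (nat \<Rightarrow> nat) \<Rightarrow> (nat \<Rightarrow> nat) \<Rightarrow> real"
  where "coeff d \<sigma> S = (\<Prod>i<d. entry (\<sigma> i) (S i))"

definition right_vec :: "nat \<Rightarrow> (nat \<Rightarrow> nat) \<Rightarrow> ell2"
  where "right_vec d \<sigma> = (\<Sum>S\<in>bits d. of_real (coeff d \<sigma> S) *\<^sub>C basis (prime_product d S))"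

definition left_vec :: "nat \<Rightarrow> (nat \<Rightarrow> nat) \<Rightarrow> ell2"
  where "left_vec d \<sigma> = (\<Sum>S\<in>bits d. of_real (coeff d \<sigma> S) *\<^sub>C basis (block_index d S))"

definition weight :: "real \<Rightarrow> nat \<Rightarrow> (nat \<Rightarrow> nat) \<Rightarrow> real"
  where "weight b d \<sigma> = (\<Prod>i<d. if \<sigma> i = 0 then 1 else b)"

text \<open>
  This is the pairing of \<open>A\<close> with the \<open>d\<close>-th tensor power of \<open>v\<^sub>0 \<otimes> v\<^sub>0 + b v\<^sub>1 \<otimes> v\<^sub>1\<close>, whose rows are
  moved to the multiples of \<open>2 ^ d\<close>.
\<close>

definition block :: "real \<Rightarrow> nat \<Rightarrow> (ell2 \<Rightarrow> ell2) \<Rightarrow> complex"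
  where "block b d A = (\<Sum>\<sigma>\<in>bits d. of_real (weight b d \<sigma>) * cinner (A (right_vec d \<sigma>)) (left_vec d \<sigma>))"

definition plane_form :: "real \<Rightarrow> nat \<Rightarrow> nat \<Rightarrow> real"
  where "plane_form b x y = entry 0 x * entry 0 y + b * entry 1 x * entry 1 y"

text \<open>
  \<open>kappa b t\<close> pairs \<open>plane_form t\<close> with the average of \<open>plane_form b\<close> over the antidiagonals of the full quarter
  plane; the antidiagonal of \<open>(x, x')\<close> has \<open>x + x' + 1\<close> entries.
\<close>

definition antidiagonal_term :: "real \<Rightarrow> real \<Rightarrow> nat \<Rightarrow> nat \<Rightarrow> nat \<Rightarrow> nat \<Rightarrow> real"
  where "antidiagonal_term b t x x' y y' =
    (if x + x' = y + y' then plane_form t x x' * plane_form b y y' / (real (x + x') + 1) else 0)"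

definition kappa :: "real \<Rightarrow> real \<Rightarrow> real"
  where "kappa b t =
    (\<Sum>x\<in>{0, 1}. \<Sum>x'\<in>{0, 1}. \<Sum>y\<in>{0, 1}. \<Sum>y'\<in>{0, 1}. antidiagonal_term b t x x' y y')"

lemma coeff_orthonormal:
  assumes "\<sigma> \<in> bits d" "\<tau> \<in> bits d"
  shows "(\<Sum>S\<in>bits d. coeff d \<sigma> S * coeff d \<tau> S) = (if \<sigma> = \<tau> then 1 else 0)"
proof -
  have "(\<Sum>S\<in>bits d. coeff d \<sigma> S * coeff d \<tau> S)
      = (\<Prod>i<d. entry (\<sigma> i) 0 * entry (\<tau> i) 0 + entry (\<sigma> i) 1 * entry (\<tau> i) 1)"
    unfolding coeff_def prod.distrib[symmetric]
    by (rule sum_bits[where G = "\<lambda>i x. entry (\<sigma> i) x * entry (\<tau> i) x"])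
  also have "\<dots> = (\<Prod>i<d. if \<sigma> i = \<tau> i then 1 else 0)"
  proof (intro prod.cong refl)
    fix i assume "i \<in> {..<d}"
    then have "\<sigma> i \<in> {0, 1}" "\<tau> i \<in> {0, 1}"
      using assms by (auto simp: bits_def PiE_iff)
    then show "entry (\<sigma> i) 0 * entry (\<tau> i) 0 + entry (\<sigma> i) 1 * entry (\<tau> i) 1
        = (if \<sigma> i = \<tau> i then 1 else 0)"
      using unit by (auto simp: entry_def power2_eq_square algebra_simps)
  qed
  also have "\<dots> = (if \<sigma> = \<tau> then 1 else 0)"
    using bits_eqI[OF assms] by (auto simp: prod_if_all)
  finally show ?thesis .
qed

lemma suborthonormal_tensor:
  assumes "inj_on n (bits d)" "\<And>S. 0 < n S"
  shows "suborthonormal (bits d) (\<lambda>\<sigma>. \<Sum>S\<in>bits d. of_real (coeff d \<sigma> S) *\<^sub>C basis (n S))"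
proof (rule suborthonormalI)
  fix \<sigma> \<tau> assume "\<sigma> \<in> bits d" "\<tau> \<in> bits d"
  then have "complex_of_real (\<Sum>S\<in>bits d. coeff d \<sigma> S * coeff d \<tau> S) = (if \<sigma> = \<tau> then 1 else 0)"
    by (simp add: coeff_orthonormal)
  then show "cinner (\<Sum>S\<in>bits d. of_real (coeff d \<sigma> S) *\<^sub>C basis (n S))
      (\<Sum>S\<in>bits d. of_real (coeff d \<tau> S) *\<^sub>C basis (n S)) = (if \<sigma> = \<tau> then 1 else 0)"
    using assms by (simp add: cinner_sum_basis finite_bits)
qed

lemma suborthonormal_right_vec: "suborthonormal (bits d) (right_vec d)"
  unfolding right_vec_def[abs_def]
  by (rule suborthonormal_tensor) (auto intro!: inj_onI bits_eqI simp: prime_product_eq_iff prime_product_pos)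

lemma suborthonormal_left_vec: "suborthonormal (bits d) (left_vec d)"
  unfolding left_vec_def[abs_def]
  by (rule suborthonormal_tensor) (auto intro!: inj_onI bits_eqI simp: block_index_eq_iff block_index_pos)

lemma sum_weight_powr: "(\<Sum>\<sigma>\<in>bits d. \<bar>weight b d \<sigma>\<bar> powr p) = (1 + \<bar>b\<bar> powr p) ^ d"
proof -
  have "\<bar>weight b d \<sigma>\<bar> powr p = (\<Prod>i<d. (if \<sigma> i = 0 then 1 else \<bar>b\<bar> powr p))" for \<sigma>
    unfolding weight_def by (induction d) (simp_all add: abs_mult powr_mult)
  then show ?thesis
    using sum_bits[of "\<lambda>i x. if x = 0 then 1 else \<bar>b\<bar> powr p" d] by simp
qed

lemma block_bound:
  assumes A: "A \<in> schatten_class q" and q: "1 < q" "1 < r" "1 / q + 1 / r = 1"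
  shows "cmod (block b d A) \<le> ((1 + \<bar>b\<bar> powr r) powr (1 / r)) ^ d * schatten_norm q A"
proof -
  have "0 < 1 + \<bar>b\<bar> powr r"
    using powr_ge_zero[of "\<bar>b\<bar>" r] by linarith
  then have "((1 + \<bar>b\<bar> powr r) ^ d) powr (1 / r) = ((1 + \<bar>b\<bar> powr r) powr (1 / r)) ^ d"
    by (simp add: powr_realpow[symmetric] powr_powr mult.commute)
  then show ?thesis
    using schatten_pairing_inequality[OF A q finite_bits[of d] suborthonormal_left_vec suborthonormal_right_vec,
        where b = "weight b d"]
    by (simp add: block_def sum_weight_powr)
qed

lemma block_helson:
  assumes A: "compact_operator A" "represents (helson_matrix \<rho>) A"
  shows "block b d A = (\<Sum>S\<in>bits d. \<Sum>S'\<in>bits d.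
    of_real (\<Prod>i<d. plane_form b (S i) (S' i)) * \<rho> (block_index d (\<lambda>i. S i + S' i)))"
proof -
  interpret A: bounded_linear A
    by (rule compact_operator_bounded_linear[OF A(1)])
  have entries: "cinner (A (basis (prime_product d S))) (basis (block_index d S'))
      = \<rho> (block_index d (\<lambda>i. S i + S' i))" for S S'
  proof -
    have "block_index d S' * prime_product d S = block_index d (\<lambda>i. S i + S' i)"
      by (simp add: block_index_def prime_product_add)
    then show ?thesis
      using A(2) prime_product_pos[of d S] block_index_pos[of d S']
      by (simp add: represents_def helson_matrix_def Suc_le_eq)
  qed
  have "cinner (A (right_vec d \<sigma>)) (left_vec d \<sigma>) = (\<Sum>S\<in>bits d. \<Sum>S'\<in>bits d.
      of_real (coeff d \<sigma> S * coeff d \<sigma> S') * \<rho> (block_index d (\<lambda>i. S i + S' i)))" for \<sigma>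
    unfolding right_vec_def left_vec_def A.sum compact_operator_scaleC[OF A(1)] cinner.sum_left
    unfolding cinner.sum_right cinner_scaleC_left cinner_scaleC_right entries
    by (simp add: mult_ac)
  then have "block b d A = (\<Sum>\<sigma>\<in>bits d. \<Sum>S\<in>bits d. \<Sum>S'\<in>bits d.
      of_real (weight b d \<sigma> * coeff d \<sigma> S * coeff d \<sigma> S') * \<rho> (block_index d (\<lambda>i. S i + S' i)))"
    by (simp add: block_def sum_distrib_left mult_ac)
  also have "\<dots> = (\<Sum>S\<in>bits d. \<Sum>\<sigma>\<in>bits d. \<Sum>S'\<in>bits d.
      of_real (weight b d \<sigma> * coeff d \<sigma> S * coeff d \<sigma> S') * \<rho> (block_index d (\<lambda>i. S i + S' i)))"
    by (rule sum.swap)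
  also have "\<dots> = (\<Sum>S\<in>bits d. \<Sum>S'\<in>bits d. \<Sum>\<sigma>\<in>bits d.
      of_real (weight b d \<sigma> * coeff d \<sigma> S * coeff d \<sigma> S') * \<rho> (block_index d (\<lambda>i. S i + S' i)))"
    by (intro sum.cong refl sum.swap)
  also have "\<dots> = (\<Sum>S\<in>bits d. \<Sum>S'\<in>bits d.
      of_real (\<Sum>\<sigma>\<in>bits d. weight b d \<sigma> * coeff d \<sigma> S * coeff d \<sigma> S') * \<rho> (block_index d (\<lambda>i. S i + S' i)))"
    by (simp add: sum_distrib_right)
  also have "\<dots> = (\<Sum>S\<in>bits d. \<Sum>S'\<in>bits d.
      of_real (\<Prod>i<d. plane_form b (S i) (S' i)) * \<rho> (block_index d (\<lambda>i. S i + S' i)))"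
  proof -
    have "(\<Sum>\<sigma>\<in>bits d. weight b d \<sigma> * coeff d \<sigma> S * coeff d \<sigma> S') = (\<Prod>i<d. plane_form b (S i) (S' i))" for S S'
      using sum_bits[of "\<lambda>i j. (if j = 0 then 1 else b) * entry j (S i) * entry j (S' i)" d]
      by (simp add: weight_def coeff_def prod.distrib plane_form_def)
    then show ?thesis by simp
  qed
  finally show ?thesis .
qed

lemma block_divisor_operator:
  "block b d' (divisor_operator (block_index d a)) =
    (if d' = d then of_real (\<Sum>R\<in>bits d. \<Sum>R'\<in>bits d.
        if \<forall>i<d. a i = R i + R' i then \<Prod>i<d. plane_form b (R i) (R' i) else 0) else 0)"
proof -
  have 1: "compact_operator (divisor_operator (block_index d a))"
    using divisor_operator_in_schatten_helson[OF block_index_pos, of 1 d a]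
    by (simp add: schatten_helson_def schatten_class_def)
  show ?thesis
    unfolding block_helson[OF 1 divisor_operator_represents[OF block_index_pos]]
    by (cases "d' = d") (auto simp: block_index_eq_iff eq_commute[of "a _"] intro!: sum.cong)
qed

text \<open>
  The functional is \<open>\<Sum>\<^sub>d (d + 1)\<^sup>-\<^sup>2 \<beta>\<^sup>-\<^sup>d block b d\<close>. It determines the coefficients of any representing
  matrix \<open>M\<close>, and with them \<open>block t d M\<close>, which comes out as
  \<open>(kappa b t / \<beta>) ^ d\<close> up to a factor \<open>(d + 1)\<^sup>3\<close>; it would have to be bounded by a multiple of \<open>\<theta> ^ d\<close>.
\<close>

theorem functional_not_representable:
  assumes q: "1 < q" "1 < r" "1 / q + 1 / r = 1"
    and gap: "(1 + \<bar>b\<bar> powr r) powr (1 / r) * (1 + \<bar>t\<bar> powr q) powr (1 / q) < kappa b t"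
  shows "\<not> schatten_helson_dual q \<subseteq> pairing_functional q ` schatten_helson r"
proof
  assume onto: "schatten_helson_dual q \<subseteq> pairing_functional q ` schatten_helson r"
  define \<beta> where "\<beta> = (1 + \<bar>b\<bar> powr r) powr (1 / r)"
  define \<theta> where "\<theta> = (1 + \<bar>t\<bar> powr q) powr (1 / q)"
  have "0 < \<beta>" "0 < \<theta>"
    using powr_ge_zero[of "\<bar>b\<bar>" r] powr_ge_zero[of "\<bar>t\<bar>" q] unfolding \<beta>_def \<theta>_def
    by (auto simp: add_nonneg_eq_0_iff intro!: powr_gt_zero[THEN iffD2])
  define \<gamma> where "\<gamma> d = 1 / ((real d + 1)\<^sup>2 * \<beta> ^ d)" for d
  have \<gamma>: "0 < \<gamma> d" for d
    using \<open>0 < \<beta>\<close> by (simp add: \<gamma>_def)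
  define \<phi> where "\<phi> A = (\<Sum>d. of_real (\<gamma> d) * block b d A)" for A
  have summable_square: "summable (\<lambda>d. 1 / (real d + 1)\<^sup>2)"
  proof -
    have "summable (\<lambda>d. inverse (real (Suc d) ^ 2))"
      using inverse_power_summable[of 2, where 'a = real] by (subst summable_Suc_iff) simp
    then show ?thesis
      by (simp add: inverse_eq_divide add.commute)
  qed
  have term_bound: "cmod (of_real (\<gamma> d) * block b d A) \<le> 1 / (real d + 1)\<^sup>2 * schatten_norm q A"
    if "A \<in> schatten_class q" for A d
  proof -
    have "cmod (of_real (\<gamma> d) * block b d A) = \<gamma> d * cmod (block b d A)"
      using \<gamma>[of d] by (simp add: norm_mult)
    also have "\<dots> \<le> \<gamma> d * (\<beta> ^ d * schatten_norm q A)"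
      using block_bound[OF that q, of b d] \<gamma>[of d] by (intro mult_left_mono) (auto simp: \<beta>_def)
    also have "\<dots> = 1 / (real d + 1)\<^sup>2 * schatten_norm q A"
      using \<open>0 < \<beta>\<close> by (simp add: \<gamma>_def)
    finally show ?thesis .
  qed
  have summable_abs: "summable (\<lambda>d. cmod (of_real (\<gamma> d) * block b d A))"
    if "A \<in> schatten_class q" for A
    by (rule summable_comparison_test'[OF summable_mult2[OF summable_square]])
      (use term_bound[OF that] in auto)
  note summable_terms = summable_norm_cancel[OF summable_abs]

  have "(\<lambda>A\<in>schatten_helson q. \<phi> A) \<in> schatten_helson_dual q"
    unfolding schatten_helson_dual_def
  proof (intro CollectI conjI ballI allI)
    fix A B assume A: "A \<in> schatten_helson q" and B: "B \<in> schatten_helson q"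
    obtain \<rho>1 \<rho>2 where "represents (helson_matrix \<rho>1) A" "represents (helson_matrix \<rho>2) B"
      using A B by (auto simp: schatten_helson_def)
    then have "represents (helson_matrix (\<lambda>k. \<rho>1 k + \<rho>2 k)) (\<lambda>x. A x + B x)"
      by (simp add: represents_def helson_matrix_def cinner_add_left)
    then have "(\<lambda>x. A x + B x) \<in> schatten_helson q"
      using A B q schatten_class_add[of A q B] by (auto simp: schatten_helson_def)
    moreover have "block b d (\<lambda>x. A x + B x) = block b d A + block b d B" for d
      by (simp add: block_def cinner_add_left distrib_left sum.distrib)
    then have "\<phi> (\<lambda>x. A x + B x) = \<phi> A + \<phi> B"
      using A B summable_terms by (simp add: \<phi>_def distrib_left suminf_add schatten_helson_def)
    ultimately show "(\<lambda>A\<in>schatten_helson q. \<phi> A) (\<lambda>x. A x + B x)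
        = (\<lambda>A\<in>schatten_helson q. \<phi> A) A + (\<lambda>A\<in>schatten_helson q. \<phi> A) B"
      using A B by simp
  next
    fix z A assume A: "A \<in> schatten_helson q"
    obtain \<rho> where "represents (helson_matrix \<rho>) A"
      using A by (auto simp: schatten_helson_def)
    then have "represents (helson_matrix (\<lambda>k. z * \<rho> k)) (\<lambda>x. z *\<^sub>C A x)"
      by (simp add: represents_def helson_matrix_def cinner_scaleC_left)
    then have "(\<lambda>x. z *\<^sub>C A x) \<in> schatten_helson q"
      using A q schatten_class_scaleC[of A q z] by (auto simp: schatten_helson_def)
    moreover have "block b d (\<lambda>x. z *\<^sub>C A x) = z * block b d A" for d
      by (simp add: block_def cinner_scaleC_left sum_distrib_left mult_ac)
    then have "\<phi> (\<lambda>x. z *\<^sub>C A x) = z * \<phi> A"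
      using A summable_terms[of A] by (simp add: \<phi>_def schatten_helson_def suminf_mult[symmetric] mult_ac)
    ultimately show "(\<lambda>A\<in>schatten_helson q. \<phi> A) (\<lambda>x. z *\<^sub>C A x) = z * (\<lambda>A\<in>schatten_helson q. \<phi> A) A"
      using A by simp
  next
    show "\<exists>C. \<forall>A\<in>schatten_helson q. cmod ((\<lambda>A\<in>schatten_helson q. \<phi> A) A) \<le> C * schatten_norm q A"
    proof (intro exI ballI)
      fix A assume A: "A \<in> schatten_helson q"
      then have A': "A \<in> schatten_class q" by (simp add: schatten_helson_def)
      have "cmod (\<phi> A) \<le> (\<Sum>d. cmod (of_real (\<gamma> d) * block b d A))"
        unfolding \<phi>_def by (rule summable_norm[OF summable_abs[OF A']])
      also have "\<dots> \<le> (\<Sum>d. 1 / (real d + 1)\<^sup>2 * schatten_norm q A)"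
        by (intro suminf_le term_bound A' summable_abs summable_mult2 summable_square)
      also have "\<dots> = (\<Sum>d. 1 / (real d + 1)\<^sup>2) * schatten_norm q A"
        by (rule suminf_mult2[OF summable_square, symmetric])
      finally show "cmod ((\<lambda>A\<in>schatten_helson q. \<phi> A) A) \<le> (\<Sum>d. 1 / (real d + 1)\<^sup>2) * schatten_norm q A"
        using A by simp
    qed
  qed simp
  with onto obtain M where M: "M \<in> schatten_helson r"
    and eq: "(\<lambda>A\<in>schatten_helson q. \<phi> A) = pairing_functional q M"
    by blast
  obtain \<rho> where \<rho>: "represents (helson_matrix \<rho>) M" and Mr: "M \<in> schatten_class r"
    using M by (auto simp: schatten_helson_def)
  note Mc = schatten_classD(1)[OF Mr]

  define U where "U d a = (\<Sum>R\<in>bits d. \<Sum>R'\<in>bits d.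
      if \<forall>i<d. a i = R i + R' i then \<Prod>i<d. plane_form b (R i) (R' i) else 0)" for d a
  \<comment> \<open>a test on the Helson matrix with a single coefficient gives \<open>\<rho>\<close> up to the number of divisors\<close>
  have coefficients: "\<rho> (block_index d a) = of_real (\<gamma> d / (real d + 1) * (U d a / (\<Prod>i<d. real (a i) + 1)))" for d a
  proof -
    let ?E = "divisor_operator (block_index d a)"
    have E: "?E \<in> schatten_helson q"
      using q by (intro divisor_operator_in_schatten_helson block_index_pos) simp
    have "\<phi> ?E = (\<Sum>d'\<in>{d}. of_real (\<gamma> d') * block b d' ?E)"
      unfolding \<phi>_def by (rule suminf_finite) (auto simp: block_divisor_operator)
    also have "\<dots> = of_real (\<gamma> d * U d a)"
      by (simp add: block_divisor_operator U_def)
    finally have "of_real (\<gamma> d * U d a) = pairing ?E M"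
      using fun_cong[OF eq, of ?E] E by (simp add: pairing_functional_def)
    also have "\<dots> = of_real ((real d + 1) * (\<Prod>i<d. real (a i) + 1)) * cnj (\<rho> (block_index d a))"
      unfolding pairing_divisor_operator[OF Mc \<rho> block_index_pos] card_divisors_block_index
      by (simp add: algebra_simps)
    finally have "cnj (of_real (\<gamma> d * U d a))
        = cnj (of_real ((real d + 1) * (\<Prod>i<d. real (a i) + 1)) * cnj (\<rho> (block_index d a)))"
      by (rule arg_cong)
    then have *: "of_real (\<gamma> d * U d a) = of_real ((real d + 1) * (\<Prod>i<d. real (a i) + 1)) * \<rho> (block_index d a)"
      by simp
    have "(real d + 1) * (\<Prod>i<d. real (a i) + 1) \<noteq> 0"
      by (simp add: add_nonneg_eq_0_iff)
    then have "complex_of_real ((real d + 1) * (\<Prod>i<d. real (a i) + 1)) \<noteq> 0"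
      by (simp only: of_real_eq_0_iff not_False_eq_True)
    then have "\<rho> (block_index d a) = of_real (\<gamma> d * U d a) / of_real ((real d + 1) * (\<Prod>i<d. real (a i) + 1))"
      unfolding * by (rule nonzero_mult_div_cancel_left[symmetric])
    then show ?thesis
      by simp
  qed
  have block_M: "block t d M = of_real (\<gamma> d / (real d + 1) * kappa b t ^ d)" for d
  proof -
    have pointwise: "(\<Prod>i<d. plane_form t (S i) (S' i)) * (U d (\<lambda>i. S i + S' i) / (\<Prod>i<d. real (S i + S' i) + 1))
        = (\<Sum>R\<in>bits d. \<Sum>R'\<in>bits d. \<Prod>i<d. antidiagonal_term b t (S i) (S' i) (R i) (R' i))" for S S'
      unfolding U_def antidiagonal_term_def prod_if_all sum_divide_distrib sum_distrib_left
      by (intro sum.cong refl) (auto simp add: prod.distrib prod_dividef simp del: of_nat_add)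
    have "block t d M = of_real (\<gamma> d / (real d + 1) * (\<Sum>S\<in>bits d. \<Sum>S'\<in>bits d.
        (\<Prod>i<d. plane_form t (S i) (S' i)) * (U d (\<lambda>i. S i + S' i) / (\<Prod>i<d. real (S i + S' i) + 1))))"
      unfolding block_helson[OF Mc \<rho>] coefficients of_real_mult[symmetric] of_real_sum[symmetric]
        sum_distrib_left of_real_eq_iff
      by (intro sum.cong refl) (simp only: ac_simps)
    also have "(\<Sum>S\<in>bits d. \<Sum>S'\<in>bits d.
        (\<Prod>i<d. plane_form t (S i) (S' i)) * (U d (\<lambda>i. S i + S' i) / (\<Prod>i<d. real (S i + S' i) + 1)))
        = kappa b t ^ d"
      unfolding pointwise sum_bits_4 kappa_def ..
    finally show ?thesis .
  qed

  define g where "g = kappa b t / (\<beta> * \<theta>)"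
  have "1 < g"
    using gap \<open>0 < \<beta>\<close> \<open>0 < \<theta>\<close> by (simp add: g_def \<beta>_def[symmetric] \<theta>_def[symmetric] field_simps)
  have growth: "1 \<le> schatten_norm r M * ((real d + 1) ^ 3 * (1 / g) ^ d)" for d
  proof -
    have "1 / r + 1 / q = 1" using q by simp
    from block_bound[OF Mr q(2,1) this, of t d]
    have "\<bar>\<gamma> d / (real d + 1) * kappa b t ^ d\<bar> \<le> \<theta> ^ d * schatten_norm r M"
      unfolding block_M norm_of_real by (simp add: \<theta>_def)
    also have "kappa b t ^ d = \<beta> ^ d * \<theta> ^ d * g ^ d"
      using \<open>0 < \<beta>\<close> \<open>0 < \<theta>\<close> by (simp add: g_def power_divide power_mult_distrib)
    finally have "\<theta> ^ d * (g ^ d / (real d + 1) ^ 3) \<le> \<theta> ^ d * schatten_norm r M"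
      using \<open>0 < \<beta>\<close> \<open>0 < \<theta>\<close> \<open>1 < g\<close>
      by (simp add: \<gamma>_def abs_mult power_abs power2_eq_square power3_eq_cube mult_ac)
    then have "g ^ d / (real d + 1) ^ 3 \<le> schatten_norm r M"
      using \<open>0 < \<theta>\<close> by (meson mult_le_cancel_left_pos zero_less_power)
    then show ?thesis
      using \<open>1 < g\<close> by (simp add: field_simps)
  qed
  \<comment> \<open>the cube root reduces the factor \<open>(d + 1)\<^sup>3\<close> to the limit of \<open>d y\<^sup>d\<close>\<close>
  define y where "y = root 3 (1 / g)"
  have y: "0 < y" "y < 1" "y ^ 3 = 1 / g"
    using \<open>1 < g\<close> by (simp_all add: y_def)
  have "(\<lambda>d. real d * y ^ d) \<longlonglongrightarrow> 0"
    using y by (intro powser_times_n_limit_0) simp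
  from tendsto_divide[OF LIMSEQ_Suc[OF this] tendsto_const[of y]]
  have "(\<lambda>d. real (Suc d) * y ^ Suc d / y) \<longlonglongrightarrow> 0 / y"
    using y(1) by (metis less_irrefl)
  then have "(\<lambda>d. schatten_norm r M * (real (Suc d) * y ^ Suc d / y) ^ 3) \<longlonglongrightarrow> schatten_norm r M * (0 / y) ^ 3"
    by (rule tendsto_mult[OF tendsto_const tendsto_power])
  moreover have "(real (Suc d) * y ^ Suc d / y) ^ 3 = (real d + 1) ^ 3 * (1 / g) ^ d" for d
    using y(1) by (simp add: power_mult_distrib y(3)[symmetric] power_mult[symmetric] mult.commute add.commute)
  ultimately have "(\<lambda>d. schatten_norm r M * ((real d + 1) ^ 3 * (1 / g) ^ d)) \<longlonglongrightarrow> 0"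
    by simp
  then have "1 \<le> (0 :: real)"
    by (rule LIMSEQ_le_const) (use growth in auto)
  then show False by simp
qed

lemma kappa_commute: "kappa b t = kappa t b"
  unfolding kappa_def antidiagonal_term_def by (simp add: ac_simps)

text \<open>
  Without averaging the pairing would be exactly 1. Averaging fixes the other entries, because both forms are
  symmetric, and it divides the contribution \<open>s\<^sup>2 (s\<^sup>2 - \<delta> c\<^sup>2)\<close> of the lower right entries by 3.
\<close>

lemma kappa_rank_one: "kappa 0 (- \<delta>) = 1 + 2 / 3 * s\<^sup>2 * (\<delta> * (1 - s\<^sup>2) - s\<^sup>2)"
proof -
  have "kappa 0 (- \<delta>) = c\<^sup>2 * (c\<^sup>2 - \<delta> * s\<^sup>2) + 2 * c\<^sup>2 * s\<^sup>2 * (1 + \<delta>) + s\<^sup>2 * (s\<^sup>2 - \<delta> * c\<^sup>2) / 3"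
    by (simp add: kappa_def antidiagonal_term_def plane_form_def entry_def power2_eq_square field_simps)
  moreover have "c\<^sup>2 = 1 - s\<^sup>2"
    using unit by simp
  ultimately show ?thesis
    by (simp add: field_simps)
qed

end

section \<open>Rotations by a small angle\<close>

text \<open>
  With \<open>h\<close> the squared sine of the angle and \<open>\<delta> = 3 h\<close>, the right-hand side is at least \<open>1 + 5 h\<^sup>2 / 6\<close>, while
  \<open>\<delta>\<^sup>p\<close> is of smaller order than \<open>h\<^sup>2\<close> because \<open>p > 2\<close>; the choice of \<open>h\<close> makes it at most \<open>h\<^sup>2\<close>, which is less
  than \<open>p \<cdot> 5 h\<^sup>2 / 6\<close>.
\<close>

lemma small_angle_exists:
  fixes p :: real
  assumes "2 < p"
  obtains h where "0 < h" "h < 1"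
    "(1 + (3 * h) powr p) powr (1 / p) < 1 + 2 / 3 * h * (3 * h * (1 - h) - h)"
proof
  define h where "h = min (1 / 4) (3 powr (- (p / (p - 2))))"
  show h: "0 < h" "h < 1"
    by (simp_all add: h_def)
  have "h powr (p - 2) \<le> (3 powr (- (p / (p - 2)))) powr (p - 2)"
    using h assms by (intro powr_mono2) (auto simp: h_def)
  also have "\<dots> = 3 powr (- p)"
    using assms by (simp add: powr_powr)
  finally have "3 powr p * h powr (p - 2) * h\<^sup>2 \<le> 3 powr p * 3 powr (- p) * h\<^sup>2"
    by (intro mult_mono) auto
  moreover have "(3 * h) powr p = 3 powr p * h powr (p - 2) * h\<^sup>2"
    using h powr_add[of h "p - 2" 2] by (simp add: powr_mult)
  ultimately have "(3 * h) powr p \<le> h\<^sup>2"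
    by (simp add: powr_minus)
  define X where "X = 2 / 3 * h * (3 * h * (1 - h) - h)"
  have "h \<le> 1 / 4" by (simp add: h_def)
  have "h * h * (3 * h) \<le> h * h * (3 / 4)"
    using h \<open>h \<le> 1 / 4\<close> by (intro mult_left_mono) auto
  then have X: "5 / 6 * h\<^sup>2 \<le> X"
    by (simp add: X_def power2_eq_square field_simps)
  then have "0 < X"
    using h by (meson less_le_trans mult_pos_pos zero_less_power zero_less_divide_iff zero_less_numeral)
  have "1 + (3 * h) powr p \<le> 1 + h\<^sup>2"
    using \<open>(3 * h) powr p \<le> h\<^sup>2\<close> by simp
  also have "\<dots> < 1 + p * X"
  proof -
    have "h\<^sup>2 < 2 * (5 / 6 * h\<^sup>2)" using h by simp
    also have "\<dots> \<le> p * X"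
      using assms X h by (intro mult_mono) auto
    finally show ?thesis by simp
  qed
  also have "\<dots> \<le> (1 + X) powr p"
    using Bernoulli_powr[of p "1 + X"] assms \<open>0 < X\<close> by simp
  finally have "(1 + (3 * h) powr p) powr (1 / p) < ((1 + X) powr p) powr (1 / p)"
    using assms by (intro powr_less_mono2) (auto intro: add_nonneg_nonneg)
  also have "\<dots> = 1 + X"
    using assms \<open>0 < X\<close> by (simp add: powr_powr)
  finally show "(1 + (3 * h) powr p) powr (1 / p) < 1 + 2 / 3 * h * (3 * h * (1 - h) - h)"
    by (simp add: X_def)
qed

theorem corollary6:
  fixes q r :: real
  assumes "1 < q" and "q \<noteq> 2" and "1 / q + 1 / r = 1"
  shows "\<not> schatten_helson_dual q \<subseteq> pairing_functional q ` schatten_helson r"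
proof -
  have "1 / r = (q - 1) / q"
    using assms by (simp add: field_simps)
  then have r_eq: "r = q / (q - 1)"
    by (metis inverse_divide inverse_eq_divide inverse_inverse_eq)
  then have "1 < r"
    using assms by simp
  \<comment> \<open>the matrix with two singular values is measured in the norm with the larger exponent\<close>
  have "2 < q \<or> 2 < r"
    unfolding r_eq using assms by (auto simp: less_divide_eq)
  then have "2 < max q r" by auto
  then obtain h where h: "0 < h" "h < 1"
    "(1 + (3 * h) powr max q r) powr (1 / max q r) < 1 + 2 / 3 * h * (3 * h * (1 - h) - h)"
    by (rule small_angle_exists)
  interpret rotation "sqrt (1 - h)" "sqrt h"
    using h by unfold_locales simp
  have kappa: "(1 + (3 * h) powr max q r) powr (1 / max q r) < kappa 0 (- (3 * h))"
    using h by (simp add: kappa_rank_one)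
  show ?thesis
  proof (cases "r \<le> q")
    case True
    then show ?thesis
      using kappa h assms \<open>1 < r\<close>
      by (intro functional_not_representable[of q r 0 "- (3 * h)"]) (auto simp: max_def split: if_splits)
  next
    case False
    then show ?thesis
      using kappa h assms \<open>1 < r\<close>
      by (intro functional_not_representable[of q r "- (3 * h)" 0])
        (auto simp: max_def kappa_commute[of _ 0] split: if_splits)
  qed
qed

end
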